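(* Let $\alpha$ be an action of an $r$-discrete groupoid $G$ on an upper semicontinuous $C^*$-bundle $\mathcal A$, and let $S$ be a full inverse semigroup of open $G$-sets. For $e\in E_S$ put $B_e=\{f\in\Gamma_0(\mathcal A): f(x)=0\text{ for }x\notin e\}$. Then there is a unique action $\beta$ of $S$ on $\Gamma_0(\mathcal A)$, with $\beta_s$ an isomorphism of $B_{d(s)}$ onto $B_{r(s)}$, such that $$\beta_s(f)(u)=\begin{cases}\alpha_{us}(f(s^*us))&\text{if }u\in r(s),\\ 0&\text{else,}\end{cases}$$ for $s\in S$, $f\in B_{d(s)}$, and $u\in G^0$.
   Context: Groupoids. A groupoid $G$ is called $r$-discrete if it is a locally compact Hausdorff topological groupoid whose range and domain maps $r,d\colon G\to G^0$, $r(x)=xx^{-1}$, $d(x)=x^{-1}x$, are local homeomorphisms ($G^0$ is the unit space; $(x,y)$ is composable iff $d(x)=r(y)$). $G^{op}$ is the set of open $G$-sets, i.e. open subsets of $G$ on which $r$ and $d$ are injective; it is an inverse semigroup with $st=\{xy: x\in s,\,y\in t,\,d(x)=r(y)\}$ and $s^*=\{x^{-1}:x\in s\}$. For $s\in G^{op}$, $d(s)=s^*s=\{d(x):x\in s\}$ and $r(s)=ss^*=\{r(x):x\in s\}$. For $u\in r(s)$, $us$ denotes the unique element of $s$ with range $u$, and $s^*us=d(us)$ is its domain. $E_S$ is the set of idempotents of $S$, ordered by $e\le f$ iff $e=ef$. An inverse subsemigroup $S$ of $G^{op}$ is full if $S$ is a base for the topology of $G$ and every two elements of $E_S$ have a common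 upper bound in $E_S$. Bundles. An upper semicontinuous $C^*$-bundle over a locally compact Hausdorff space $X$ is a topological space $\mathcal A$ with a continuous open surjection $p\colon\mathcal A\to X$ whose fibres $A_u=p^{-1}(u)$ are $C^*$-algebras, such that $a\mapsto\|a\|$ is upper semicontinuous on $\mathcal A$; scalar multiplication, involution, and (on $\{(a,b):p(a)=p(b)\}$) addition and multiplication are continuous; and $a_i\to 0_u$ whenever $p(a_i)\to u$ and $\|a_i\|\to0$. $\Gamma_0(\mathcal A)$ is the $C^*$-algebra (sup norm) of continuous sections $f$ such that $\{u:\|f(u)\|\ge\epsilon\}$ is compact for all $\epsilon>0$. Groupoid actions. An action $\alpha$ of $G$ on an upper semicontinuous $C^*$-bundle $\mathcal A$ over $G^0$ is a family of $^*$-homomorphisms $\alpha_x\colon A_{d(x)}\to A_{r(x)}$, $x\in G$, with $\alpha_x\alpha_y=\alpha_{xy}$ for $d(x)=r(y)$ and $\alpha_u=\mathrm{id}$ for $u\in G^0$, such that $(x,a)\mapsto\alpha_x(a)$ is continuous from $d^*\mathcal A=\{(x,a)\in G\times\mathcal A: a\in A_{d(x)}\}$ to $\mathcal A$. Inverse semigroup actions. A partial automorphism of a $C^*$-algebra $B$ is an isomorphism between two closed ideals of $B$; these form an inverse semigroup $\mathrm{PAut}\,B$ under composition (on the largest possible domain). An action of an inverse semigroup $S$ on $B$ is a homomorphism $\beta\colon S\to\mathrm{PAut}\,B$ such that the domain ideals of the $\beta_s$ are upward-directed (any two are contained in a third) and have dense span in $B$. *)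

theory Defs
  imports "HOL-Analysis.Analysis"
begin

section \<open>C*-algebras with explicit carriers\<close>

text \<open>The fibres of a bundle are C*-algebras living on different subsets of one type, so all
  structure is relative to a carrier. Algebras are complex and not assumed unital; the zero
  algebra is allowed.\<close>

record 'b cstar_struct =
  cs_carrier :: "'b set"
  cs_zero :: 'b
  cs_add :: "'b \<Rightarrow> 'b \<Rightarrow> 'b"
  cs_scale :: "complex \<Rightarrow> 'b \<Rightarrow> 'b"
  cs_mult :: "'b \<Rightarrow> 'b \<Rightarrow> 'b"
  cs_star :: "'b \<Rightarrow> 'b"
  cs_norm :: "'b \<Rightarrow> real"

text \<open>The value 0 off the carrier is there because \<open>Metric_space\<close> wants a
  symmetric nonnegative distance on the whole type.\<close>

definition cs_dist :: "'b cstar_struct \<Rightarrow> 'b \<Rightarrow> 'b \<Rightarrow> real" where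
  "cs_dist B x y =
     (if x \<in> cs_carrier B \<and> y \<in> cs_carrier B
      then cs_norm B (cs_add B x (cs_scale B (-1) y)) else 0)"

definition cs_topology :: "'b cstar_struct \<Rightarrow> 'b topology" where
  "cs_topology B = Metric_space.mtopology (cs_carrier B) (cs_dist B)"

locale cstar_algebra =
  fixes B :: "'b cstar_struct"
  assumes zero_closed: "cs_zero B \<in> cs_carrier B"
    and add_closed: "\<lbrakk>x \<in> cs_carrier B; y \<in> cs_carrier B\<rbrakk> \<Longrightarrow> cs_add B x y \<in> cs_carrier B"
    and scale_closed: "x \<in> cs_carrier B \<Longrightarrow> cs_scale B c x \<in> cs_carrier B"
    and mult_closed: "\<lbrakk>x \<in> cs_carrier B; y \<in> cs_carrier B\<rbrakk> \<Longrightarrow> cs_mult B x y \<in> cs_carrier B"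
    and star_closed: "x \<in> cs_carrier B \<Longrightarrow> cs_star B x \<in> cs_carrier B"
    and add_assoc: "\<lbrakk>x \<in> cs_carrier B; y \<in> cs_carrier B; z \<in> cs_carrier B\<rbrakk> \<Longrightarrow>
          cs_add B (cs_add B x y) z = cs_add B x (cs_add B y z)"
    and add_commute: "\<lbrakk>x \<in> cs_carrier B; y \<in> cs_carrier B\<rbrakk> \<Longrightarrow> cs_add B x y = cs_add B y x"
    and add_zero: "x \<in> cs_carrier B \<Longrightarrow> cs_add B (cs_zero B) x = x"
    and add_inverse: "x \<in> cs_carrier B \<Longrightarrow> \<exists>y\<in>cs_carrier B. cs_add B x y = cs_zero B"
    and scale_one: "x \<in> cs_carrier B \<Longrightarrow> cs_scale B 1 x = x"
    and scale_scale: "x \<in> cs_carrier B \<Longrightarrow> cs_scale B a (cs_scale B c x) = cs_scale B (a * c) x"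
    and scale_add_left: "x \<in> cs_carrier B \<Longrightarrow>
          cs_scale B (a + c) x = cs_add B (cs_scale B a x) (cs_scale B c x)"
    and scale_add_right: "\<lbrakk>x \<in> cs_carrier B; y \<in> cs_carrier B\<rbrakk> \<Longrightarrow>
          cs_scale B c (cs_add B x y) = cs_add B (cs_scale B c x) (cs_scale B c y)"
    and mult_assoc: "\<lbrakk>x \<in> cs_carrier B; y \<in> cs_carrier B; z \<in> cs_carrier B\<rbrakk> \<Longrightarrow>
          cs_mult B (cs_mult B x y) z = cs_mult B x (cs_mult B y z)"
    and mult_add_left: "\<lbrakk>x \<in> cs_carrier B; y \<in> cs_carrier B; z \<in> cs_carrier B\<rbrakk> \<Longrightarrow>
          cs_mult B (cs_add B x y) z = cs_add B (cs_mult B x z) (cs_mult B y z)"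
    and mult_add_right: "\<lbrakk>x \<in> cs_carrier B; y \<in> cs_carrier B; z \<in> cs_carrier B\<rbrakk> \<Longrightarrow>
          cs_mult B x (cs_add B y z) = cs_add B (cs_mult B x y) (cs_mult B x z)"
    and mult_scale_left: "\<lbrakk>x \<in> cs_carrier B; y \<in> cs_carrier B\<rbrakk> \<Longrightarrow>
          cs_mult B (cs_scale B c x) y = cs_scale B c (cs_mult B x y)"
    and mult_scale_right: "\<lbrakk>x \<in> cs_carrier B; y \<in> cs_carrier B\<rbrakk> \<Longrightarrow>
          cs_mult B x (cs_scale B c y) = cs_scale B c (cs_mult B x y)"
    and star_star: "x \<in> cs_carrier B \<Longrightarrow> cs_star B (cs_star B x) = x"
    and star_add: "\<lbrakk>x \<in> cs_carrier B; y \<in> cs_carrier B\<rbrakk> \<Longrightarrow>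
          cs_star B (cs_add B x y) = cs_add B (cs_star B x) (cs_star B y)"
    and star_scale: "x \<in> cs_carrier B \<Longrightarrow>
          cs_star B (cs_scale B c x) = cs_scale B (cnj c) (cs_star B x)"
    and star_mult: "\<lbrakk>x \<in> cs_carrier B; y \<in> cs_carrier B\<rbrakk> \<Longrightarrow>
          cs_star B (cs_mult B x y) = cs_mult B (cs_star B y) (cs_star B x)"
    and norm_nonneg: "x \<in> cs_carrier B \<Longrightarrow> 0 \<le> cs_norm B x"
    and norm_eq_zero: "x \<in> cs_carrier B \<Longrightarrow> cs_norm B x = 0 \<longleftrightarrow> x = cs_zero B"
    and norm_scale: "x \<in> cs_carrier B \<Longrightarrow> cs_norm B (cs_scale B c x) = cmod c * cs_norm B x"
    and norm_triangle: "\<lbrakk>x \<in> cs_carrier B; y \<in> cs_carrier B\<rbrakk> \<Longrightarrow>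
          cs_norm B (cs_add B x y) \<le> cs_norm B x + cs_norm B y"
    and norm_mult: "\<lbrakk>x \<in> cs_carrier B; y \<in> cs_carrier B\<rbrakk> \<Longrightarrow>
          cs_norm B (cs_mult B x y) \<le> cs_norm B x * cs_norm B y"
    and cstar_identity: "x \<in> cs_carrier B \<Longrightarrow> cs_norm B (cs_mult B (cs_star B x) x) = (cs_norm B x)\<^sup>2"
    and complete: "Metric_space.mcomplete (cs_carrier B) (cs_dist B)"

definition star_hom :: "'b cstar_struct \<Rightarrow> 'c cstar_struct \<Rightarrow> ('b \<Rightarrow> 'c) \<Rightarrow> bool" where
  "star_hom B C \<phi> \<longleftrightarrow>
     (\<forall>x\<in>cs_carrier B. \<phi> x \<in> cs_carrier C) \<and>
     (\<forall>x\<in>cs_carrier B. \<forall>y\<in>cs_carrier B. \<phi> (cs_add B x y) = cs_add C (\<phi> x) (\<phi> y)) \<and>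
     (\<forall>c. \<forall>x\<in>cs_carrier B. \<phi> (cs_scale B c x) = cs_scale C c (\<phi> x)) \<and>
     (\<forall>x\<in>cs_carrier B. \<forall>y\<in>cs_carrier B. \<phi> (cs_mult B x y) = cs_mult C (\<phi> x) (\<phi> y)) \<and>
     (\<forall>x\<in>cs_carrier B. \<phi> (cs_star B x) = cs_star C (\<phi> x))"

definition star_iso :: "'b cstar_struct \<Rightarrow> 'c cstar_struct \<Rightarrow> ('b \<Rightarrow> 'c) \<Rightarrow> bool" where
  "star_iso B C \<phi> \<longleftrightarrow> star_hom B C \<phi> \<and> bij_betw \<phi> (cs_carrier B) (cs_carrier C)"

definition cs_subspace :: "'b cstar_struct \<Rightarrow> 'b set \<Rightarrow> bool" where
  "cs_subspace B V \<longleftrightarrow>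
     V \<subseteq> cs_carrier B \<and> cs_zero B \<in> V \<and>
     (\<forall>x\<in>V. \<forall>y\<in>V. cs_add B x y \<in> V) \<and> (\<forall>c. \<forall>x\<in>V. cs_scale B c x \<in> V)"

definition closed_ideal :: "'b cstar_struct \<Rightarrow> 'b set \<Rightarrow> bool" where
  "closed_ideal B I \<longleftrightarrow>
     cs_subspace B I \<and>
     (\<forall>x\<in>I. \<forall>b\<in>cs_carrier B. cs_mult B b x \<in> I \<and> cs_mult B x b \<in> I) \<and>
     closedin (cs_topology B) I"


section \<open>Partial automorphisms and inverse semigroup actions\<close>

text \<open>Partial automorphisms are partial functions, so that \<open>map_comp\<close> is
  composition on the largest possible domain.\<close>

definition partial_iso :: "'b cstar_struct \<Rightarrow> 'b set \<Rightarrow> 'b set \<Rightarrow> ('b \<rightharpoonup> 'b) \<Rightarrow> bool" where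
  "partial_iso B I J \<phi> \<longleftrightarrow>
     dom \<phi> = I \<and> ran \<phi> = J \<and>
     star_iso (B\<lparr>cs_carrier := I\<rparr>) (B\<lparr>cs_carrier := J\<rparr>) (\<lambda>x. the (\<phi> x))"

definition paut :: "'b cstar_struct \<Rightarrow> ('b \<rightharpoonup> 'b) set" where
  "paut B = {\<phi>. \<exists>I J. closed_ideal B I \<and> closed_ideal B J \<and> partial_iso B I J \<phi>}"

locale inverse_semigroup =
  fixes S :: "'s set" and m :: "'s \<Rightarrow> 's \<Rightarrow> 's"
  assumes sg_closed: "\<lbrakk>s \<in> S; t \<in> S\<rbrakk> \<Longrightarrow> m s t \<in> S"
    and sg_assoc: "\<lbrakk>s \<in> S; t \<in> S; w \<in> S\<rbrakk> \<Longrightarrow> m (m s t) w = m s (m t w)"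
    and sg_inverse: "s \<in> S \<Longrightarrow> \<exists>!t. t \<in> S \<and> m (m s t) s = s \<and> m (m t s) t = t"

text \<open>As a map defined on \<open>S\<close> only, an action is taken to be extensional (undefined off \<open>S\<close>),
  so that equality of actions is equality on \<open>S\<close>.\<close>

locale inverse_semigroup_action = inverse_semigroup S m + cstar_algebra B
  for S :: "'s set" and m :: "'s \<Rightarrow> 's \<Rightarrow> 's" and B :: "'b cstar_struct" +
  fixes \<beta> :: "'s \<Rightarrow> 'b \<rightharpoonup> 'b"
  assumes act_paut: "\<beta> \<in> S \<rightarrow>\<^sub>E paut B"
    and act_mult: "\<lbrakk>s \<in> S; t \<in> S\<rbrakk> \<Longrightarrow> \<beta> (m s t) = \<beta> s \<circ>\<^sub>m \<beta> t"
    and act_directed: "\<lbrakk>s \<in> S; t \<in> S\<rbrakk> \<Longrightarrow> \<exists>w\<in>S. dom (\<beta> s) \<subseteq> dom (\<beta> w) \<and> dom (\<beta> t) \<subseteq> dom (\<beta> w)"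
    and act_dense: "cs_topology B closure_of (cs_subspace B hull (\<Union>s\<in>S. dom (\<beta> s))) = cs_carrier B"


section \<open>r-discrete groupoids and open G-sets\<close>

text \<open>The underlying set of the groupoid is the topspace of its topology; the product
  \<open>g_mult G x y\<close> is meaningful only for composable pairs, i.e. when
  \<open>g_d G x = g_r G y\<close>.\<close>

record 'g groupoid_struct =
  g_top :: "'g topology"
  g_mult :: "'g \<Rightarrow> 'g \<Rightarrow> 'g"
  g_inv :: "'g \<Rightarrow> 'g"

abbreviation g_carrier :: "'g groupoid_struct \<Rightarrow> 'g set" where
  "g_carrier G \<equiv> topspace (g_top G)"

definition g_r :: "'g groupoid_struct \<Rightarrow> 'g \<Rightarrow> 'g" where
  "g_r G x = g_mult G x (g_inv G x)"

definition g_d :: "'g groupoid_struct \<Rightarrow> 'g \<Rightarrow> 'g" where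
  "g_d G x = g_mult G (g_inv G x) x"

definition g_units :: "'g groupoid_struct \<Rightarrow> 'g set" where
  "g_units G = g_r G ` g_carrier G"

definition unit_space :: "'g groupoid_struct \<Rightarrow> 'g topology" where
  "unit_space G = subtopology (g_top G) (g_units G)"

locale groupoid =
  fixes G :: "'g groupoid_struct"
  assumes g_mult_closed: "\<lbrakk>x \<in> g_carrier G; y \<in> g_carrier G; g_d G x = g_r G y\<rbrakk> \<Longrightarrow>
          g_mult G x y \<in> g_carrier G"
    and g_inv_closed: "x \<in> g_carrier G \<Longrightarrow> g_inv G x \<in> g_carrier G"
    and g_inv_inv: "x \<in> g_carrier G \<Longrightarrow> g_inv G (g_inv G x) = x"
    and g_r_mult: "\<lbrakk>x \<in> g_carrier G; y \<in> g_carrier G; g_d G x = g_r G y\<rbrakk> \<Longrightarrow>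
          g_r G (g_mult G x y) = g_r G x"
    and g_d_mult: "\<lbrakk>x \<in> g_carrier G; y \<in> g_carrier G; g_d G x = g_r G y\<rbrakk> \<Longrightarrow>
          g_d G (g_mult G x y) = g_d G y"
    and g_mult_assoc:
         "\<lbrakk>x \<in> g_carrier G; y \<in> g_carrier G; z \<in> g_carrier G; g_d G x = g_r G y; g_d G y = g_r G z\<rbrakk> \<Longrightarrow>
          g_mult G (g_mult G x y) z = g_mult G x (g_mult G y z)"
    and g_cancel_left: "\<lbrakk>x \<in> g_carrier G; y \<in> g_carrier G; g_d G x = g_r G y\<rbrakk> \<Longrightarrow>
          g_mult G (g_inv G x) (g_mult G x y) = y"
    and g_cancel_right: "\<lbrakk>x \<in> g_carrier G; y \<in> g_carrier G; g_d G x = g_r G y\<rbrakk> \<Longrightarrow>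
          g_mult G (g_mult G x y) (g_inv G y) = x"

definition local_homeomorphism :: "'p topology \<Rightarrow> 'q topology \<Rightarrow> ('p \<Rightarrow> 'q) \<Rightarrow> bool" where
  "local_homeomorphism X Y f \<longleftrightarrow>
     f \<in> topspace X \<rightarrow> topspace Y \<and>
     (\<forall>x\<in>topspace X. \<exists>U. openin X U \<and> x \<in> U \<and> openin Y (f ` U) \<and>
        homeomorphic_map (subtopology X U) (subtopology Y (f ` U)) f)"

locale r_discrete_groupoid = groupoid +
  assumes g_locally_compact: "locally_compact_space (g_top G)"
    and g_Hausdorff: "Hausdorff_space (g_top G)"
    and g_mult_continuous:
         "continuous_map
            (subtopology (prod_topology (g_top G) (g_top G)) {(x, y). g_d G x = g_r G y})
            (g_top G) (\<lambda>(x, y). g_mult G x y)"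
    and g_inv_continuous: "continuous_map (g_top G) (g_top G) (g_inv G)"
    and g_r_local_homeo: "local_homeomorphism (g_top G) (unit_space G) (g_r G)"
    and g_d_local_homeo: "local_homeomorphism (g_top G) (unit_space G) (g_d G)"

definition open_gsets :: "'g groupoid_struct \<Rightarrow> 'g set set" where
  "open_gsets G = {s. openin (g_top G) s \<and> inj_on (g_r G) s \<and> inj_on (g_d G) s}"

definition gset_mult :: "'g groupoid_struct \<Rightarrow> 'g set \<Rightarrow> 'g set \<Rightarrow> 'g set" where
  "gset_mult G s t = {g_mult G x y | x y. x \<in> s \<and> y \<in> t \<and> g_d G x = g_r G y}"

definition gset_star :: "'g groupoid_struct \<Rightarrow> 'g set \<Rightarrow> 'g set" where
  "gset_star G s = g_inv G ` s"

text \<open>The element \<open>us\<close> of \<open>s\<close> with range \<open>u\<close>.\<close>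

definition gset_at :: "'g groupoid_struct \<Rightarrow> 'g \<Rightarrow> 'g set \<Rightarrow> 'g" where
  "gset_at G u s = (THE x. x \<in> s \<and> g_r G x = u)"

definition gset_idempotents :: "'g groupoid_struct \<Rightarrow> 'g set set \<Rightarrow> 'g set set" where
  "gset_idempotents G S = {e \<in> S. gset_mult G e e = e}"

definition full_inverse_subsemigroup :: "'g groupoid_struct \<Rightarrow> 'g set set \<Rightarrow> bool" where
  "full_inverse_subsemigroup G S \<longleftrightarrow>
     S \<subseteq> open_gsets G \<and>
     (\<forall>s\<in>S. \<forall>t\<in>S. gset_mult G s t \<in> S) \<and>
     (\<forall>s\<in>S. gset_star G s \<in> S) \<and>
     openin (g_top G) = arbitrary union_of (\<lambda>U. U \<in> S) \<and>
     (\<forall>e\<in>gset_idempotents G S. \<forall>f\<in>gset_idempotents G S.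
        \<exists>h\<in>gset_idempotents G S. e = gset_mult G e h \<and> f = gset_mult G f h)"


section \<open>Upper semicontinuous C*-bundles\<close>

text \<open>The total space is the topspace of \<open>b_top\<close>. Fibres are disjoint, so a single
  operation on the type serves all fibres; only the zero element needs the base point.\<close>

record ('a, 'x) bundle_struct =
  b_top :: "'a topology"
  b_proj :: "'a \<Rightarrow> 'x"
  b_zero :: "'x \<Rightarrow> 'a"
  b_add :: "'a \<Rightarrow> 'a \<Rightarrow> 'a"
  b_scale :: "complex \<Rightarrow> 'a \<Rightarrow> 'a"
  b_mult :: "'a \<Rightarrow> 'a \<Rightarrow> 'a"
  b_star :: "'a \<Rightarrow> 'a"
  b_norm :: "'a \<Rightarrow> real"

definition fibre :: "('a, 'x) bundle_struct \<Rightarrow> 'x \<Rightarrow> 'a cstar_struct" where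
  "fibre A u =
     \<lparr>cs_carrier = {a \<in> topspace (b_top A). b_proj A a = u},
      cs_zero = b_zero A u, cs_add = b_add A, cs_scale = b_scale A,
      cs_mult = b_mult A, cs_star = b_star A, cs_norm = b_norm A\<rparr>"

text \<open>In \<open>zero_limit\<close>, the nets \<open>a\<^sub>i\<close> in the total space are replaced by filters on
  it: a net enters through the image of its filter of tails.\<close>

locale usc_cstar_bundle =
  fixes X :: "'x topology" and A :: "('a, 'x) bundle_struct"
  assumes base_locally_compact: "locally_compact_space X"
    and base_Hausdorff: "Hausdorff_space X"
    and proj_continuous: "continuous_map (b_top A) X (b_proj A)"
    and proj_open: "open_map (b_top A) X (b_proj A)"
    and proj_surj: "b_proj A ` topspace (b_top A) = topspace X"
    and fibre_cstar: "u \<in> topspace X \<Longrightarrow> cstar_algebra (fibre A u)"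
    and norm_usc: "openin (b_top A) {a \<in> topspace (b_top A). b_norm A a < c}"
    and scale_continuous:
         "continuous_map (prod_topology euclidean (b_top A)) (b_top A) (\<lambda>(c, a). b_scale A c a)"
    and star_continuous: "continuous_map (b_top A) (b_top A) (b_star A)"
    and add_continuous:
         "continuous_map
            (subtopology (prod_topology (b_top A) (b_top A)) {(a, b). b_proj A a = b_proj A b})
            (b_top A) (\<lambda>(a, b). b_add A a b)"
    and mult_continuous:
         "continuous_map
            (subtopology (prod_topology (b_top A) (b_top A)) {(a, b). b_proj A a = b_proj A b})
            (b_top A) (\<lambda>(a, b). b_mult A a b)"
    and zero_limit:
         "\<lbrakk>u \<in> topspace X; \<forall>\<^sub>F a in F. a \<in> topspace (b_top A);
           limitin X (b_proj A) u F; (b_norm A \<longlongrightarrow> 0) F\<rbrakk>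
          \<Longrightarrow> limitin (b_top A) (\<lambda>a. a) (b_zero A u) F"

text \<open>Sections are extensional functions on the base. The 0 inserted under the supremum only
  matters for the empty base.\<close>

definition Gamma0 :: "'x topology \<Rightarrow> ('a, 'x) bundle_struct \<Rightarrow> ('x \<Rightarrow> 'a) cstar_struct" where
  "Gamma0 X A =
     \<lparr>cs_carrier =
        {f \<in> (\<Pi>\<^sub>E u\<in>topspace X. cs_carrier (fibre A u)).
           continuous_map X (b_top A) f \<and>
           (\<forall>\<epsilon>>0. compactin X {u \<in> topspace X. b_norm A (f u) \<ge> \<epsilon>})},
      cs_zero = (\<lambda>u\<in>topspace X. b_zero A u),
      cs_add = (\<lambda>f g. \<lambda>u\<in>topspace X. b_add A (f u) (g u)),
      cs_scale = (\<lambda>c f. \<lambda>u\<in>topspace X. b_scale A c (f u)),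
      cs_mult = (\<lambda>f g. \<lambda>u\<in>topspace X. b_mult A (f u) (g u)),
      cs_star = (\<lambda>f. \<lambda>u\<in>topspace X. b_star A (f u)),
      cs_norm = (\<lambda>f. Sup (insert 0 ((\<lambda>u. b_norm A (f u)) ` topspace X)))\<rparr>"

text \<open>The ideal \<open>B\<^sub>e\<close> of sections vanishing off \<open>e\<close>.\<close>

definition Gamma0_on :: "'x topology \<Rightarrow> ('a, 'x) bundle_struct \<Rightarrow> 'x set \<Rightarrow> ('x \<Rightarrow> 'a) set" where
  "Gamma0_on X A e =
     {f \<in> cs_carrier (Gamma0 X A). \<forall>x\<in>topspace X - e. f x = b_zero A x}"


section \<open>Groupoid actions on bundles\<close>

locale groupoid_action =
  fixes G :: "'g groupoid_struct" and A :: "('a, 'g) bundle_struct" and \<alpha> :: "'g \<Rightarrow> 'a \<Rightarrow> 'a"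
  assumes act_hom: "x \<in> g_carrier G \<Longrightarrow> star_hom (fibre A (g_d G x)) (fibre A (g_r G x)) (\<alpha> x)"
    and act_comp: "\<lbrakk>x \<in> g_carrier G; y \<in> g_carrier G; g_d G x = g_r G y;
          a \<in> cs_carrier (fibre A (g_d G y))\<rbrakk> \<Longrightarrow> \<alpha> x (\<alpha> y a) = \<alpha> (g_mult G x y) a"
    and act_unit: "\<lbrakk>u \<in> g_units G; a \<in> cs_carrier (fibre A u)\<rbrakk> \<Longrightarrow> \<alpha> u a = a"
    and act_continuous:
         "continuous_map
            (subtopology (prod_topology (g_top G) (b_top A)) {(x, a). b_proj A a = g_d G x})
            (b_top A) (\<lambda>(x, a). \<alpha> x a)"

end

theory Submission
  imports Defs
begin

text \<open>Each \<open>\<alpha>\<^sub>x\<close> is continuous at 0 because the action is jointly continuous, hence bounded, and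
  then contractive by the C*-identity. So \<open>\<beta>\<^sub>s f\<close> is continuous on the open set \<open>r(s)\<close>, while the
  sets where its norm is at least \<open>\<epsilon>\<close> lie in compact subsets of \<open>r(s)\<close>; this gives continuity off
  \<open>r(s)\<close> and membership in \<open>\<Gamma>\<^sub>0\<close>. The map \<open>\<beta>\<^sub>s\<close> is inverted by \<open>\<beta>\<close> of \<open>s\<^sup>*\<close>, and \<open>\<beta>\<close> is multiplicative
  because each \<open>\<alpha>\<^sub>y\<close> is injective, so that \<open>\<beta>\<^sub>t f\<close> vanishes off \<open>d(s)\<close> exactly when \<open>f\<close> vanishes off
  \<open>d(st)\<close>. Density: a section has norm at least \<open>\<epsilon>\<close> only on a compact set, which an idempotent of \<open>S\<close>
  contains, and a Urysohn function cuts the section off outside that idempotent.\<close>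

section \<open>C*-algebras\<close>

text \<open>The bundle norm is only upper semicontinuous, so it governs the topology of the total
  space only near zero vectors: over a small neighbourhood of u, every vector of small norm lies in
  a prescribed neighbourhood of the zero of the fibre at u. Continuity arguments for sections that
  are not mere compositions are therefore brought down to zero, by subtracting an approximant or by
  looking at a point where the section vanishes. Upper semicontinuity does give what
  \<open>Gamma0\<close> needs: sets {norm >= \<epsilon>} are closed, and sections are bounded.
  Contractivity matters because a bound on \<open>\<alpha> x\<close> that varied with x would not by
  itself relate the set where f is large to the set where the transported section is large; with
  constant 1 the same \<epsilon> serves on both sides. An action, as defined here, includes the
  assertions that the sections form a C*-algebra and that inverses in S are unique. The first rests
  on completeness, where a continuous section has to be recovered from limits taken in single
  fibres; the second on injectivity of r and d.\<close>

context cstar_algebra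
begin

lemma norm_zero: "cs_norm B (cs_zero B) = 0"
  using norm_eq_zero zero_closed by blast

text \<open>Homogeneity and definiteness of the norm replace cancellation in the additive
  group.\<close>

lemma scale_zero: "x \<in> cs_carrier B \<Longrightarrow> cs_scale B 0 x = cs_zero B"
  using norm_scale[of x 0] norm_eq_zero scale_closed by simp

lemma scale_zero_right: "cs_scale B c (cs_zero B) = cs_zero B"
  using norm_scale[of "cs_zero B" c] norm_eq_zero scale_closed zero_closed norm_zero by simp

lemma star_zero: "cs_star B (cs_zero B) = cs_zero B"
  by (metis scale_zero zero_closed star_closed star_scale complex_cnj_zero)

lemma mult_zero_left: "x \<in> cs_carrier B \<Longrightarrow> cs_mult B (cs_zero B) x = cs_zero B"
  by (metis mult_closed mult_scale_left scale_zero zero_closed)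

lemma mult_zero_right: "x \<in> cs_carrier B \<Longrightarrow> cs_mult B x (cs_zero B) = cs_zero B"
  by (metis mult_closed mult_scale_right scale_zero zero_closed)

lemma add_minus: "x \<in> cs_carrier B \<Longrightarrow> cs_add B x (cs_scale B (-1) x) = cs_zero B"
  using scale_add_left[of x 1 "-1"] by (simp add: scale_one scale_zero)

lemma add_diff_cancel:
  assumes "x \<in> cs_carrier B" "y \<in> cs_carrier B"
  shows "cs_add B x (cs_add B y (cs_scale B (-1) x)) = y"
proof -
  have c: "cs_scale B (-1) x \<in> cs_carrier B"
    using assms by (simp add: scale_closed)
  have "cs_add B x (cs_add B y (cs_scale B (-1) x)) = cs_add B (cs_add B x (cs_scale B (-1) x)) y"
    using assms c by (simp add: add_assoc add_commute[of y])
  then show ?thesis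
    using assms by (simp add: add_minus add_zero)
qed

lemma diff_eq_zero:
  assumes "x \<in> cs_carrier B" "y \<in> cs_carrier B"
  shows "cs_add B x (cs_scale B (-1) y) = cs_zero B \<longleftrightarrow> x = y"
  by (metis assms add_commute add_diff_cancel add_minus add_zero zero_closed)

lemma diff_zero:
  assumes "x \<in> cs_carrier B"
  shows "cs_add B x (cs_scale B (-1) (cs_zero B)) = x"
  by (metis assms add_commute add_zero scale_zero_right zero_closed)

lemma diff_add_diff:
  assumes "x \<in> cs_carrier B" "y \<in> cs_carrier B" "z \<in> cs_carrier B"
  shows "cs_add B (cs_add B x (cs_scale B (-1) y)) (cs_add B y (cs_scale B (-1) z))
    = cs_add B x (cs_scale B (-1) z)"
proof -
  let ?y = "cs_scale B (-1) y" and ?z = "cs_scale B (-1) z"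
  have c: "?y \<in> cs_carrier B" "?z \<in> cs_carrier B"
    using assms by (simp_all add: scale_closed)
  have "cs_add B (cs_add B x ?y) (cs_add B y ?z) = cs_add B x (cs_add B (cs_add B ?y y) ?z)"
    using assms c by (simp add: add_assoc add_closed)
  also have "cs_add B ?y y = cs_zero B"
    using assms c by (simp add: add_commute[of ?y y] add_minus)
  finally show ?thesis
    using c by (simp add: add_zero)
qed

lemma cs_metric: "Metric_space (cs_carrier B) (cs_dist B)"
proof
  show "0 \<le> cs_dist B x y" for x y
    by (simp add: cs_dist_def norm_nonneg add_closed scale_closed)
  show "cs_dist B x y = cs_dist B y x" for x y
  proof (cases "x \<in> cs_carrier B \<and> y \<in> cs_carrier B")
    case True
    then have "cs_add B y (cs_scale B (-1) x) = cs_scale B (-1) (cs_add B x (cs_scale B (-1) y))"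
      by (simp add: scale_add_right scale_closed scale_scale scale_one add_commute)
    then show ?thesis
      using True by (simp add: cs_dist_def norm_scale add_closed scale_closed)
  qed (auto simp: cs_dist_def)
  show "cs_dist B x y = 0 \<longleftrightarrow> x = y" if "x \<in> cs_carrier B" "y \<in> cs_carrier B" for x y
    using that by (simp add: cs_dist_def norm_eq_zero add_closed scale_closed diff_eq_zero)
  show "cs_dist B x z \<le> cs_dist B x y + cs_dist B y z"
    if "x \<in> cs_carrier B" "y \<in> cs_carrier B" "z \<in> cs_carrier B" for x y z
    using norm_triangle[of "cs_add B x (cs_scale B (-1) y)" "cs_add B y (cs_scale B (-1) z)"] that
    by (simp add: cs_dist_def diff_add_diff add_closed scale_closed)
qed

lemma cs_dist_eq:
  "\<lbrakk>x \<in> cs_carrier B; y \<in> cs_carrier B\<rbrakk> \<Longrightarrow>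
    cs_dist B x y = cs_norm B (cs_add B x (cs_scale B (-1) y))"
  by (simp add: cs_dist_def)

lemma cs_dist_zero: "x \<in> cs_carrier B \<Longrightarrow> cs_dist B x (cs_zero B) = cs_norm B x"
  by (simp add: cs_dist_eq zero_closed diff_zero)

end

text \<open>\<open>star_hom\<close> has no clause for zero; compatibility with the scalar 0 supplies
  it.\<close>

lemma star_hom_zero:
  assumes "cstar_algebra B" "cstar_algebra C" "star_hom B C \<phi>"
  shows "\<phi> (cs_zero B) = cs_zero C"
proof -
  interpret B: cstar_algebra B by fact
  interpret C: cstar_algebra C by fact
  show ?thesis
    using assms(3) unfolding star_hom_def by (metis B.scale_zero B.zero_closed C.scale_zero)
qed

text \<open>By the C*-identity a bound \<open>K\<close> for a *-homomorphism can be improved to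
  \<open>sqrt K\<close>, and iterating this the bounds tend to 1.\<close>

lemma star_hom_contractive:
  assumes "cstar_algebra B" "cstar_algebra C" and hom: "star_hom B C \<phi>"
    and bound: "\<And>x. x \<in> cs_carrier B \<Longrightarrow> cs_norm C (\<phi> x) \<le> K * cs_norm B x"
    and x: "x \<in> cs_carrier B"
  shows "cs_norm C (\<phi> x) \<le> cs_norm B x"
proof -
  interpret B: cstar_algebra B by fact
  interpret C: cstar_algebra C by fact
  \<comment> \<open>K may be zero or negative; the positive bound L makes \<open>powr\<close> behave
    and gives \<open>L powr 0 = 1\<close> in the limit.\<close>
  define L where "L = max K 1"
  have "L > 0" by (simp add: L_def)
  have iter: "cs_norm C (\<phi> y) \<le> L powr ((1/2) ^ n) * cs_norm B y" if "y \<in> cs_carrier B" for n y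
    using that
  proof (induction n arbitrary: y)
    case 0
    have "K * cs_norm B y \<le> L * cs_norm B y"
      by (rule mult_right_mono) (auto simp: L_def B.norm_nonneg 0)
    with bound[OF 0] show ?case
      using \<open>L > 0\<close> by simp
  next
    case (Suc n)
    let ?z = "cs_mult B (cs_star B y) y"
    have "(cs_norm C (\<phi> y))\<^sup>2 = cs_norm C (\<phi> ?z)"
      using Suc.prems hom by (simp add: star_hom_def C.cstar_identity B.star_closed)
    also have "\<dots> \<le> L powr ((1/2) ^ n) * cs_norm B ?z"
      by (rule Suc.IH) (simp add: Suc.prems B.mult_closed B.star_closed)
    also have "\<dots> = (L powr ((1/2) ^ Suc n) * cs_norm B y)\<^sup>2"
      using Suc.prems \<open>L > 0\<close>
      by (simp add: B.cstar_identity power_mult_distrib power2_eq_square flip: powr_add)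
    finally show ?case
      using power2_le_imp_le B.norm_nonneg Suc.prems by fastforce
  qed
  have "(\<lambda>n. L powr ((1/2) ^ n) * cs_norm B x) \<longlonglongrightarrow> L powr 0 * cs_norm B x"
    using \<open>L > 0\<close> by (intro tendsto_intros LIMSEQ_realpow_zero) auto
  then have "(\<lambda>n. L powr ((1/2) ^ n) * cs_norm B x) \<longlonglongrightarrow> cs_norm B x"
    using \<open>L > 0\<close> by simp
  then show ?thesis
    by (rule LIMSEQ_le_const) (use iter[OF x] in auto)
qed

text \<open>Agreement on the carrier transfers the homomorphism identities only if the operations
  stay in the carrier, hence the closure assumptions. It serves carriers that are ideals, where
  \<open>the\<close> of a partial map agrees with its total version.\<close>

lemma star_iso_cong:
  assumes iso: "star_iso B C \<phi>" and eq: "\<And>x. x \<in> cs_carrier B \<Longrightarrow> \<psi> x = \<phi> x"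
    and "\<And>x y. \<lbrakk>x \<in> cs_carrier B; y \<in> cs_carrier B\<rbrakk> \<Longrightarrow> cs_add B x y \<in> cs_carrier B"
    and "\<And>c x. x \<in> cs_carrier B \<Longrightarrow> cs_scale B c x \<in> cs_carrier B"
    and "\<And>x y. \<lbrakk>x \<in> cs_carrier B; y \<in> cs_carrier B\<rbrakk> \<Longrightarrow> cs_mult B x y \<in> cs_carrier B"
    and "\<And>x. x \<in> cs_carrier B \<Longrightarrow> cs_star B x \<in> cs_carrier B"
  shows "star_iso B C \<psi>"
proof -
  have "bij_betw \<psi> (cs_carrier B) (cs_carrier C)"
    using iso bij_betw_cong[of "cs_carrier B" \<psi> \<phi>] eq by (simp add: star_iso_def)
  moreover have "star_hom B C \<psi>"
    using iso assms(3-6) unfolding star_iso_def star_hom_def by (simp add: eq)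
  ultimately show ?thesis by (simp add: star_iso_def)
qed

section \<open>Upper semicontinuous bundles\<close>

lemma continuous_mapI_nbhd:
  assumes "\<And>x. x \<in> topspace X \<Longrightarrow> f x \<in> topspace Y"
    and "\<And>x V. \<lbrakk>x \<in> topspace X; openin Y V; f x \<in> V\<rbrakk> \<Longrightarrow>
          \<exists>U. openin X U \<and> x \<in> U \<and> (\<forall>y\<in>U. f y \<in> V)"
  shows "continuous_map X Y f"
  unfolding continuous_map_def
proof (intro conjI allI impI)
  show "f \<in> topspace X \<rightarrow> topspace Y" using assms(1) by auto
  fix V assume V: "openin Y V"
  show "openin X {x \<in> topspace X. f x \<in> V}"
  proof (subst openin_subopen, clarify)
    fix x assume "x \<in> topspace X" "f x \<in> V"
    then obtain U where "openin X U" "x \<in> U" "\<forall>y\<in>U. f y \<in> V"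
      using assms(2) V by blast
    then show "\<exists>U. openin X U \<and> x \<in> U \<and> U \<subseteq> {x \<in> topspace X. f x \<in> V}"
      using openin_subset[of X U] by (intro exI[of _ U]) auto
  qed
qed

lemma fibre_sel [simp]:
  "cs_zero (fibre A u) = b_zero A u" "cs_add (fibre A u) = b_add A"
  "cs_scale (fibre A u) = b_scale A" "cs_mult (fibre A u) = b_mult A"
  "cs_star (fibre A u) = b_star A" "cs_norm (fibre A u) = b_norm A"
  by (simp_all add: fibre_def)

lemma fibre_carrier_iff:
  "a \<in> cs_carrier (fibre A u) \<longleftrightarrow> a \<in> topspace (b_top A) \<and> b_proj A a = u"
  by (simp add: fibre_def)

lemma Gamma0_sel:
  "cs_zero (Gamma0 X A) = (\<lambda>u\<in>topspace X. b_zero A u)"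
  "cs_add (Gamma0 X A) f g = (\<lambda>u\<in>topspace X. b_add A (f u) (g u))"
  "cs_scale (Gamma0 X A) c f = (\<lambda>u\<in>topspace X. b_scale A c (f u))"
  "cs_mult (Gamma0 X A) f g = (\<lambda>u\<in>topspace X. b_mult A (f u) (g u))"
  "cs_star (Gamma0 X A) f = (\<lambda>u\<in>topspace X. b_star A (f u))"
  by (simp_all add: Gamma0_def)

text \<open>The right-hand sides use \<open>fibre A u\<close> instead of the bundle operations so
  that the C*-laws of the fibre can rewrite them; \<open>fibre_sel\<close> would undo this and is
  removed from the simp set in such proofs.\<close>

lemma Gamma0_apply:
  assumes "u \<in> topspace X"
  shows "cs_zero (Gamma0 X A) u = cs_zero (fibre A u)"
    "cs_add (Gamma0 X A) f g u = cs_add (fibre A u) (f u) (g u)"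
    "cs_scale (Gamma0 X A) c f u = cs_scale (fibre A u) c (f u)"
    "cs_mult (Gamma0 X A) f g u = cs_mult (fibre A u) (f u) (g u)"
    "cs_star (Gamma0 X A) f u = cs_star (fibre A u) (f u)"
  using assms by (simp_all add: Gamma0_def)

lemma Gamma0_on_mono: "e \<subseteq> h \<Longrightarrow> Gamma0_on X A e \<subseteq> Gamma0_on X A h"
  unfolding Gamma0_on_def by blast

section \<open>Neighbourhoods of zero vectors and uniform limits of sections\<close>

context usc_cstar_bundle
begin

lemma fibre_in_base: "a \<in> topspace (b_top A) \<Longrightarrow> b_proj A a \<in> topspace X"
  using proj_surj by blast

text \<open>This is \<open>zero_limit\<close> freed of filters. F is the largest filter that
  satisfies the filter premises of \<open>zero_limit\<close>; it converges to the zero at u, so N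
  contains one of its generating sets, cut out by a base neighbourhood and a norm bound.\<close>

lemma zero_nbhd:
  assumes "u \<in> topspace X" "openin (b_top A) N" "b_zero A u \<in> N"
  obtains U \<delta> where "openin X U" "u \<in> U" "\<delta> > 0"
    "\<And>b. \<lbrakk>b \<in> topspace (b_top A); b_proj A b \<in> U; b_norm A b < \<delta>\<rbrakk> \<Longrightarrow> b \<in> N"
proof -
  define F where "F = inf (principal (topspace (b_top A)))
    (inf (filtercomap (b_proj A) (nhdsin X u)) (filtercomap (b_norm A) (nhds 0)))"
  have 1: "\<forall>\<^sub>F a in F. a \<in> topspace (b_top A)"
    unfolding F_def by (rule filter_leD[OF inf_le1]) (simp add: eventually_principal)
  have 2: "limitin X (b_proj A) u F"
    unfolding limitin_def
  proof (intro conjI allI impI)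
    fix U assume "openin X U \<and> u \<in> U"
    then have "eventually (\<lambda>v. v \<in> U) (nhdsin X u)"
      using assms(1) by (auto simp: eventually_nhdsin)
    then have "eventually (\<lambda>a. b_proj A a \<in> U) (filtercomap (b_proj A) (nhdsin X u))"
      by (auto simp: eventually_filtercomap)
    then show "eventually (\<lambda>a. b_proj A a \<in> U) F"
      unfolding F_def by (meson filter_leD inf_le1 inf_le2)
  qed (use assms in auto)
  have 3: "(b_norm A \<longlongrightarrow> 0) F"
    unfolding F_def by (meson filterlim_filtercomap filterlim_mono inf_le2 order_refl)
  have "\<forall>\<^sub>F a in F. a \<in> N"
    using zero_limit[OF _ 1 2 3] assms by (auto simp: limitin_def)
  then obtain P Q where P: "eventually P (filtercomap (b_proj A) (nhdsin X u))"
      and Q: "eventually Q (filtercomap (b_norm A) (nhds 0))"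
      and PQ: "\<And>a. a \<in> topspace (b_top A) \<Longrightarrow> P a \<Longrightarrow> Q a \<Longrightarrow> a \<in> N"
    unfolding F_def eventually_inf eventually_principal by blast
  obtain U where U: "openin X U" "u \<in> U" "\<And>a. b_proj A a \<in> U \<Longrightarrow> P a"
    using P assms(1) by (auto simp: eventually_filtercomap eventually_nhdsin)
  obtain \<delta> where \<delta>: "\<delta> > 0" "\<And>a. \<bar>b_norm A a\<bar> < \<delta> \<Longrightarrow> Q a"
    using Q by (auto simp: eventually_filtercomap eventually_nhds_metric dist_real_def)
  show thesis
  proof (rule that[OF U(1,2) \<delta>(1)])
    fix b assume b: "b \<in> topspace (b_top A)" "b_proj A b \<in> U" "b_norm A b < \<delta>"
    \<comment> \<open>The filter controls the absolute value of the norm, so the bound from below is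
      needed as well.\<close>
    then have "b_norm A b \<ge> 0"
      using cstar_algebra.norm_nonneg[OF fibre_cstar, of "b_proj A b" b] fibre_in_base
      by (simp add: fibre_carrier_iff)
    with b show "b \<in> N" using PQ U \<delta> by auto
  qed
qed

lemma continuous_map_add:
  assumes "continuous_map Z (b_top A) f" "continuous_map Z (b_top A) g"
    and "\<And>z. z \<in> topspace Z \<Longrightarrow> b_proj A (f z) = b_proj A (g z)"
  shows "continuous_map Z (b_top A) (\<lambda>z. b_add A (f z) (g z))"
  using continuous_map_compose[OF _ add_continuous, of Z "\<lambda>z. (f z, g z)"] assms
  by (simp add: o_def continuous_map_in_subtopology continuous_map_pairedI Pi_iff)

lemma continuous_map_mult:
  assumes "continuous_map Z (b_top A) f" "continuous_map Z (b_top A) g"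
    and "\<And>z. z \<in> topspace Z \<Longrightarrow> b_proj A (f z) = b_proj A (g z)"
  shows "continuous_map Z (b_top A) (\<lambda>z. b_mult A (f z) (g z))"
  using continuous_map_compose[OF _ mult_continuous, of Z "\<lambda>z. (f z, g z)"] assms
  by (simp add: o_def continuous_map_in_subtopology continuous_map_pairedI Pi_iff)

lemma continuous_map_scale:
  assumes "continuous_map Z euclidean c" "continuous_map Z (b_top A) f"
  shows "continuous_map Z (b_top A) (\<lambda>z. b_scale A (c z) (f z))"
  using continuous_map_compose[OF _ scale_continuous, of Z "\<lambda>z. (c z, f z)"] assms
  by (simp add: o_def continuous_map_pairedI)

lemma proj_op:
  assumes "a \<in> topspace (b_top A)" "b \<in> topspace (b_top A)" "b_proj A a = b_proj A b"
  shows "b_proj A (b_add A a b) = b_proj A a" "b_proj A (b_scale A c a) = b_proj A a"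
  using cstar_algebra.add_closed[OF fibre_cstar, of "b_proj A a" a b]
    cstar_algebra.scale_closed[OF fibre_cstar, of "b_proj A a" a c] assms fibre_in_base
  by (simp_all add: fibre_carrier_iff)

text \<open>Near \<open>f u\<close> one finds, over every nearby point \<open>v\<close>, some \<open>b\<close> close to the
  approximating section (the projection is open); then \<open>f v = b + (f v - b)\<close> with a small
  second summand, and addition is continuous at \<open>(f u, 0)\<close>.\<close>

lemma continuous_section_uniform_limit:
  assumes f: "\<And>u. u \<in> topspace X \<Longrightarrow> f u \<in> cs_carrier (fibre A u)"
    and approx: "\<And>\<epsilon>. \<epsilon> > 0 \<Longrightarrow> \<exists>g. continuous_map X (b_top A) g \<and>
      (\<forall>u\<in>topspace X. g u \<in> cs_carrier (fibre A u) \<and> cs_dist (fibre A u) (f u) (g u) < \<epsilon>)"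
  shows "continuous_map X (b_top A) f"
proof (rule continuous_mapI_nbhd)
  show "f u \<in> topspace (b_top A)" if "u \<in> topspace X" for u
    using f[OF that] by (simp add: fibre_carrier_iff)
  fix u W assume u: "u \<in> topspace X" and W: "openin (b_top A) W" "f u \<in> W"
  interpret F: cstar_algebra "fibre A u" by (rule fibre_cstar[OF u])
  let ?P = "subtopology (prod_topology (b_top A) (b_top A)) {(a, b). b_proj A a = b_proj A b}"
  have zero: "b_zero A u \<in> topspace (b_top A)" "b_proj A (b_zero A u) = u"
    using F.zero_closed by (simp_all add: fibre_carrier_iff)
  have fu: "f u \<in> topspace (b_top A)" "b_proj A (f u) = u"
    using f[OF u] by (simp_all add: fibre_carrier_iff)
  have "b_add A (f u) (b_zero A u) = f u"
    using F.add_zero[OF f[OF u]] F.add_commute[OF f[OF u] F.zero_closed] by simp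
  then have "(f u, b_zero A u) \<in> {z \<in> topspace ?P. (\<lambda>(a, b). b_add A a b) z \<in> W}"
    using W fu zero by simp
  moreover have "openin ?P {z \<in> topspace ?P. (\<lambda>(a, b). b_add A a b) z \<in> W}"
    using openin_continuous_map_preimage[OF add_continuous W(1)] .
  ultimately obtain T where T: "openin (prod_topology (b_top A) (b_top A)) T" "(f u, b_zero A u) \<in> T"
      "{z \<in> topspace ?P. (\<lambda>(a, b). b_add A a b) z \<in> W} = T \<inter> {(a, b). b_proj A a = b_proj A b}"
    unfolding openin_subtopology by blast
  have TW: "b_add A a b \<in> W" if "(a, b) \<in> T" "b_proj A a = b_proj A b" for a b
  proof -
    have "(a, b) \<in> T \<inter> {(a, b). b_proj A a = b_proj A b}"
      using that by simp
    then show ?thesis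
      by (subst (asm) T(3)[symmetric]) simp
  qed
  obtain V N where VN: "openin (b_top A) V" "openin (b_top A) N" "f u \<in> V" "b_zero A u \<in> N"
      "V \<times> N \<subseteq> T"
    using T(1)[unfolded openin_prod_topology_alt, rule_format, OF T(2)] by (elim exE conjE)
  obtain U \<delta> where U: "openin X U" "u \<in> U" "\<delta> > 0"
    "\<And>b. \<lbrakk>b \<in> topspace (b_top A); b_proj A b \<in> U; b_norm A b < \<delta>\<rbrakk> \<Longrightarrow> b \<in> N"
    using zero_nbhd[OF u VN(2,4)] by blast
  \<comment> \<open>Half of \<delta> is spent on the distance from f to g and half on the distance
    from g to b, so that f v - b has norm below \<delta>.\<close>
  obtain g where g: "continuous_map X (b_top A) g"
      "\<And>v. v \<in> topspace X \<Longrightarrow> g v \<in> cs_carrier (fibre A v)"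
      "\<And>v. v \<in> topspace X \<Longrightarrow> cs_dist (fibre A v) (f v) (g v) < \<delta>/2"
    using approx[of "\<delta>/2"] U(3) by auto
  \<comment> \<open>The difference between g and the identity is formed on the whole total space,
    where it is continuous; upper semicontinuity then makes the set of vectors b close to g
    open.\<close>
  define q where "q = (\<lambda>b. b_add A (g (b_proj A b)) (b_scale A (-1) b))"
  have gp: "b_proj A (g (b_proj A b)) = b_proj A b" "g (b_proj A b) \<in> topspace (b_top A)"
    if "b \<in> topspace (b_top A)" for b
    using g(2)[OF fibre_in_base[OF that]] by (simp_all add: fibre_carrier_iff)
  have gc: "continuous_map (b_top A) (b_top A) (\<lambda>b. g (b_proj A b))"
    using continuous_map_compose[OF proj_continuous g(1)] by (simp add: o_def)
  have sc: "continuous_map (b_top A) (b_top A) (\<lambda>b. b_scale A (-1) b)"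
    by (rule continuous_map_scale) auto
  have "continuous_map (b_top A) (b_top A) q"
    unfolding q_def by (rule continuous_map_add[OF gc sc]) (simp add: gp proj_op(2))
  then have "openin (b_top A) {b \<in> topspace (b_top A). q b \<in> {a \<in> topspace (b_top A). b_norm A a < \<delta>/2}}"
    by (rule openin_continuous_map_preimage[OF _ norm_usc])
  then have Q: "openin (b_top A) {b \<in> topspace (b_top A). q b \<in> topspace (b_top A) \<and> b_norm A (q b) < \<delta>/2}"
    (is "openin _ ?Q") by simp
  have nq: "b_norm A (q b) = cs_dist (fibre A v) (g v) b" "q b \<in> topspace (b_top A)"
    if "b \<in> cs_carrier (fibre A v)" "v \<in> topspace X" for v b
    using cstar_algebra.cs_dist_eq[OF fibre_cstar[OF that(2)] g(2)[OF that(2)] that(1)] that(1)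
      cstar_algebra.add_closed[OF fibre_cstar[OF that(2)] g(2)[OF that(2)]
        cstar_algebra.scale_closed[OF fibre_cstar[OF that(2)] that(1)], of "-1"]
    by (simp_all add: q_def fibre_carrier_iff)
  define R where "R = V \<inter> ?Q \<inter> {b \<in> topspace (b_top A). b_proj A b \<in> U}"
  have R: "openin (b_top A) R"
    unfolding R_def using VN(1) Q openin_continuous_map_preimage[OF proj_continuous U(1)] by blast
  have "f u \<in> R"
    unfolding R_def using VN(3) U(2) fu f[OF u] nq[OF f[OF u] u] g(3)[OF u]
      Metric_space.commute[OF F.cs_metric] by simp
  show "\<exists>U. openin X U \<and> u \<in> U \<and> (\<forall>v\<in>U. f v \<in> W)"
  proof (intro exI conjI ballI)
    show "openin X (b_proj A ` R)"
      using proj_open R by (simp add: open_map_def)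
    show "u \<in> b_proj A ` R" using \<open>f u \<in> R\<close> fu(2) by force
    fix v assume "v \<in> b_proj A ` R"
    then obtain b where b: "b \<in> R" "v = b_proj A b" by blast
    then have bt: "b \<in> topspace (b_top A)" by (auto simp: R_def)
    then have v: "v \<in> topspace X" using b fibre_in_base by simp
    interpret Fv: cstar_algebra "fibre A v" by (rule fibre_cstar[OF v])
    have bF: "b \<in> cs_carrier (fibre A v)" using bt b by (simp add: fibre_carrier_iff)
    let ?c = "b_add A (f v) (b_scale A (-1) b)"
    have cF: "?c \<in> cs_carrier (fibre A v)"
      using Fv.add_closed[OF f[OF v] Fv.scale_closed[OF bF, of "-1"]] by simp
    have "cs_dist (fibre A v) (f v) b \<le> cs_dist (fibre A v) (f v) (g v) + cs_dist (fibre A v) (g v) b"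
      by (rule Metric_space.triangle[OF Fv.cs_metric f[OF v] g(2)[OF v] bF])
    also have "\<dots> < \<delta>"
      using g(3)[OF v] nq[OF bF v] b(1) by (simp add: R_def)
    finally have "b_norm A ?c < \<delta>"
      using Fv.cs_dist_eq[OF f[OF v] bF] by simp
    then have "?c \<in> N" using U(4)[of ?c] cF b by (auto simp: fibre_carrier_iff R_def)
    then have "(b, ?c) \<in> T" using VN(5) b(1) by (auto simp: R_def)
    then have "b_add A b ?c \<in> W" using TW cF bF by (simp add: fibre_carrier_iff)
    then show "f v \<in> W" using Fv.add_diff_cancel[OF bF f[OF v]] by simp
  qed
qed

section \<open>Sections vanishing at infinity: membership and the sup norm\<close>

lemma Gamma0_fibre:
  "\<lbrakk>f \<in> cs_carrier (Gamma0 X A); u \<in> topspace X\<rbrakk> \<Longrightarrow> f u \<in> cs_carrier (fibre A u)"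
  by (auto simp: Gamma0_def)

lemma Gamma0_eqI:
  assumes "f \<in> cs_carrier (Gamma0 X A)" "g \<in> cs_carrier (Gamma0 X A)"
    and "\<And>u. u \<in> topspace X \<Longrightarrow> f u = g u"
  shows "f = g"
  using assms unfolding Gamma0_def by (auto intro: PiE_ext)

lemma Gamma0_continuous: "f \<in> cs_carrier (Gamma0 X A) \<Longrightarrow> continuous_map X (b_top A) f"
  by (simp add: Gamma0_def)

lemma Gamma0_compact:
  "\<lbrakk>f \<in> cs_carrier (Gamma0 X A); \<epsilon> > 0\<rbrakk> \<Longrightarrow> compactin X {u \<in> topspace X. b_norm A (f u) \<ge> \<epsilon>}"
  by (simp add: Gamma0_def)

lemma norm_section_open:
  assumes "continuous_map X (b_top A) f"
  shows "openin X {u \<in> topspace X. b_norm A (f u) < c}"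
proof -
  have "{u \<in> topspace X. b_norm A (f u) < c}
      = {u \<in> topspace X. f u \<in> {a \<in> topspace (b_top A). b_norm A a < c}}"
    using continuous_map_funspace[OF assms] by auto
  then show ?thesis
    using openin_continuous_map_preimage[OF assms norm_usc] by simp
qed

text \<open>Inclusion in some compact K is enough: upper semicontinuity of the norm makes the set
  {norm of h >= \<epsilon>} closed, and a closed subset of a compact set is compact.\<close>

lemma Gamma0_I:
  assumes cont: "continuous_map X (b_top A) h"
    and fib: "\<And>u. u \<in> topspace X \<Longrightarrow> h u \<in> cs_carrier (fibre A u)"
    and K: "\<And>\<epsilon>. \<epsilon> > 0 \<Longrightarrow> \<exists>K. compactin X K \<and> (\<forall>u\<in>topspace X. \<epsilon> \<le> b_norm A (h u) \<longrightarrow> u \<in> K)"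
  shows "restrict h (topspace X) \<in> cs_carrier (Gamma0 X A)"
proof -
  have "compactin X {u \<in> topspace X. \<epsilon> \<le> b_norm A (h u)}" if "\<epsilon> > 0" for \<epsilon>
  proof -
    obtain K where K: "compactin X K" "{u \<in> topspace X. \<epsilon> \<le> b_norm A (h u)} \<subseteq> K"
      using K \<open>\<epsilon> > 0\<close> by blast
    have "{u \<in> topspace X. \<epsilon> \<le> b_norm A (h u)} = topspace X - {u \<in> topspace X. b_norm A (h u) < \<epsilon>}"
      by auto
    then have "closedin X {u \<in> topspace X. \<epsilon> \<le> b_norm A (h u)}"
      using norm_section_open[OF cont] by auto
    then show ?thesis using K closed_compactin by blast
  qed
  moreover have "continuous_map X (b_top A) (restrict h (topspace X))"
    by (rule continuous_map_eq[OF cont]) simp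
  moreover have "{u \<in> topspace X. \<epsilon> \<le> b_norm A (restrict h (topspace X) u)}
      = {u \<in> topspace X. \<epsilon> \<le> b_norm A (h u)}" for \<epsilon>
    by auto
  ultimately show ?thesis
    using fib by (simp add: Gamma0_def)
qed

text \<open>Outside the compact set {norm >= 1} the bound 1 holds; on it, the increasing open sets
  {norm < n} form a cover with a finite subcover.\<close>

lemma Gamma0_bounded:
  assumes f: "f \<in> cs_carrier (Gamma0 X A)"
  obtains c where "c > 0" "\<And>u. u \<in> topspace X \<Longrightarrow> b_norm A (f u) \<le> c"
proof -
  define W where "W = (\<lambda>n::nat. {u \<in> topspace X. b_norm A (f u) < real n})"
  have "\<And>u. \<exists>n. b_norm A (f u) < real n" by (rule reals_Archimedean2)
  then have "{u \<in> topspace X. b_norm A (f u) \<ge> 1} \<subseteq> \<Union>(range W)"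
    unfolding W_def by auto
  moreover have "\<And>U. U \<in> range W \<Longrightarrow> openin X U"
    unfolding W_def using norm_section_open[OF Gamma0_continuous[OF f]] by auto
  ultimately obtain \<F> where \<F>: "finite \<F>" "\<F> \<subseteq> range W" "{u \<in> topspace X. b_norm A (f u) \<ge> 1} \<subseteq> \<Union>\<F>"
    using compactinD[OF Gamma0_compact[OF f zero_less_one], of "range W"] by blast
  then obtain N where N: "finite N" "\<F> = W ` N"
    by (meson finite_subset_image)
  \<comment> \<open>The inserted 0 keeps \<open>Max\<close> meaningful when the finite subcover is
    empty.\<close>
  have "b_norm A (f u) \<le> max 1 (real (Max (insert 0 N)))" if u: "u \<in> topspace X" for u
  proof (cases "b_norm A (f u) \<ge> 1")
    case True
    then obtain n where n: "n \<in> N" "u \<in> W n" using \<F>(3) u N by blast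
    then have "n \<le> Max (insert 0 N)" using N(1) by simp
    then show ?thesis using n(2) unfolding W_def by (auto simp: max_def)
  qed auto
  then show thesis using that[of "max 1 (real (Max (insert 0 N)))"] by simp
qed

text \<open>The real \<open>Sup\<close> is an upper bound only of sets that are bounded above, which
  is where \<open>Gamma0_bounded\<close> enters.\<close>

lemma Gamma0_norm_upper:
  assumes "f \<in> cs_carrier (Gamma0 X A)" "u \<in> topspace X"
  shows "cs_norm (fibre A u) (f u) \<le> cs_norm (Gamma0 X A) f"
proof -
  obtain c where "c > 0" "\<And>u. u \<in> topspace X \<Longrightarrow> b_norm A (f u) \<le> c"
    using Gamma0_bounded[OF assms(1)] by blast
  then have "bdd_above (insert 0 ((\<lambda>u. b_norm A (f u)) ` topspace X))"
    by (intro bdd_aboveI[of _ c]) auto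
  then show ?thesis
    using assms(2) by (auto simp: Gamma0_def intro!: cSup_upper)
qed

lemma Gamma0_norm_nonneg:
  assumes "f \<in> cs_carrier (Gamma0 X A)"
  shows "0 \<le> cs_norm (Gamma0 X A) f"
proof -
  obtain c where "c > 0" "\<And>u. u \<in> topspace X \<Longrightarrow> b_norm A (f u) \<le> c"
    using Gamma0_bounded[OF assms(1)] by blast
  then have "bdd_above (insert 0 ((\<lambda>u. b_norm A (f u)) ` topspace X))"
    by (intro bdd_aboveI[of _ c]) auto
  then show ?thesis
    by (auto simp: Gamma0_def intro!: cSup_upper)
qed

lemma Gamma0_norm_least:
  assumes "0 \<le> c" "\<And>u. u \<in> topspace X \<Longrightarrow> cs_norm (fibre A u) (f u) \<le> c"
  shows "cs_norm (Gamma0 X A) f \<le> c"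
  using assms by (auto simp: Gamma0_def intro!: cSup_least)

text \<open>All zero vectors have norm 0, so \<open>zero_nbhd\<close> captures every one of them
  over U.\<close>

lemma zero_section_continuous: "continuous_map X (b_top A) (b_zero A)"
proof (rule continuous_mapI_nbhd)
  fix u assume u: "u \<in> topspace X"
  interpret F: cstar_algebra "fibre A u" by (rule fibre_cstar[OF u])
  show "b_zero A u \<in> topspace (b_top A)"
    using F.zero_closed by (simp add: fibre_carrier_iff)
  fix V assume "openin (b_top A) V" "b_zero A u \<in> V"
  then obtain U \<delta> where U: "openin X U" "u \<in> U" "\<delta> > 0"
    "\<And>b. \<lbrakk>b \<in> topspace (b_top A); b_proj A b \<in> U; b_norm A b < \<delta>\<rbrakk> \<Longrightarrow> b \<in> V"
    using zero_nbhd[OF u, of V] by blast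
  have "b_zero A v \<in> V" if "v \<in> U" for v
  proof -
    have "v \<in> topspace X" using openin_subset[OF U(1)] that by blast
    then interpret F: cstar_algebra "fibre A v" by (rule fibre_cstar)
    show ?thesis
      using F.zero_closed F.norm_zero U that by (auto simp: fibre_carrier_iff)
  qed
  then show "\<exists>U. openin X U \<and> u \<in> U \<and> (\<forall>y\<in>U. b_zero A y \<in> V)"
    using U by blast
qed

section \<open>Closure of the sections under the algebra operations\<close>

lemma Gamma0_zero_closed: "cs_zero (Gamma0 X A) \<in> cs_carrier (Gamma0 X A)"
proof -
  have "restrict (b_zero A) (topspace X) \<in> cs_carrier (Gamma0 X A)"
  proof (rule Gamma0_I[OF zero_section_continuous])
    fix u assume "u \<in> topspace X"
    then show "b_zero A u \<in> cs_carrier (fibre A u)"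
      using cstar_algebra.zero_closed[OF fibre_cstar, of u] by simp
  next
    fix \<epsilon> :: real assume "\<epsilon> > 0"
    then have "\<forall>u\<in>topspace X. \<epsilon> \<le> b_norm A (b_zero A u) \<longrightarrow> u \<in> {}"
      using cstar_algebra.norm_zero[OF fibre_cstar] by auto
    then show "\<exists>K. compactin X K \<and> (\<forall>u\<in>topspace X. \<epsilon> \<le> b_norm A (b_zero A u) \<longrightarrow> u \<in> K)"
      by (intro exI[of _ "{}"]) simp
  qed
  then show ?thesis by (simp add: Gamma0_sel)
qed

lemma Gamma0_add_closed:
  assumes f: "f \<in> cs_carrier (Gamma0 X A)" and g: "g \<in> cs_carrier (Gamma0 X A)"
  shows "cs_add (Gamma0 X A) f g \<in> cs_carrier (Gamma0 X A)"
proof -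
  have "(\<lambda>u\<in>topspace X. b_add A (f u) (g u)) \<in> cs_carrier (Gamma0 X A)"
  proof (rule Gamma0_I)
    show "continuous_map X (b_top A) (\<lambda>u. b_add A (f u) (g u))"
      using Gamma0_fibre[OF f] Gamma0_fibre[OF g]
      by (intro continuous_map_add Gamma0_continuous f g) (simp add: fibre_carrier_iff)
    fix u assume u: "u \<in> topspace X"
    show "b_add A (f u) (g u) \<in> cs_carrier (fibre A u)"
      using cstar_algebra.add_closed[OF fibre_cstar[OF u] Gamma0_fibre[OF f u] Gamma0_fibre[OF g u]]
      by simp
  next
    fix \<epsilon> :: real assume "\<epsilon> > 0"
    let ?K = "{u \<in> topspace X. b_norm A (f u) \<ge> \<epsilon>/2} \<union> {u \<in> topspace X. b_norm A (g u) \<ge> \<epsilon>/2}"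
    have "compactin X ?K"
      using f g \<open>\<epsilon> > 0\<close> by (intro compactin_Un Gamma0_compact) auto
    moreover have "u \<in> ?K" if u: "u \<in> topspace X" and n: "\<epsilon> \<le> b_norm A (b_add A (f u) (g u))" for u
      using cstar_algebra.norm_triangle[OF fibre_cstar[OF u] Gamma0_fibre[OF f u] Gamma0_fibre[OF g u]]
        n u by auto
    ultimately show "\<exists>K. compactin X K \<and>
        (\<forall>u\<in>topspace X. \<epsilon> \<le> b_norm A (b_add A (f u) (g u)) \<longrightarrow> u \<in> K)"
      by blast
  qed
  then show ?thesis by (simp add: Gamma0_sel)
qed

lemma Gamma0_mult_closed:
  assumes f: "f \<in> cs_carrier (Gamma0 X A)" and g: "g \<in> cs_carrier (Gamma0 X A)"
  shows "cs_mult (Gamma0 X A) f g \<in> cs_carrier (Gamma0 X A)"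
proof -
  obtain c where c: "c > 0" "\<And>u. u \<in> topspace X \<Longrightarrow> b_norm A (g u) \<le> c"
    using Gamma0_bounded[OF g] by blast
  have "(\<lambda>u\<in>topspace X. b_mult A (f u) (g u)) \<in> cs_carrier (Gamma0 X A)"
  proof (rule Gamma0_I)
    show "continuous_map X (b_top A) (\<lambda>u. b_mult A (f u) (g u))"
      using Gamma0_fibre[OF f] Gamma0_fibre[OF g]
      by (intro continuous_map_mult Gamma0_continuous f g) (simp add: fibre_carrier_iff)
    fix u assume u: "u \<in> topspace X"
    show "b_mult A (f u) (g u) \<in> cs_carrier (fibre A u)"
      using cstar_algebra.mult_closed[OF fibre_cstar[OF u] Gamma0_fibre[OF f u] Gamma0_fibre[OF g u]]
      by simp
  next
    fix \<epsilon> :: real assume "\<epsilon> > 0"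
    let ?K = "{u \<in> topspace X. b_norm A (f u) \<ge> \<epsilon>/c}"
    have "compactin X ?K"
      using f \<open>\<epsilon> > 0\<close> c(1) by (intro Gamma0_compact) auto
    moreover have "u \<in> ?K" if u: "u \<in> topspace X" and n: "\<epsilon> \<le> b_norm A (b_mult A (f u) (g u))" for u
    proof -
      have "\<epsilon> \<le> b_norm A (f u) * b_norm A (g u)"
        using cstar_algebra.norm_mult[OF fibre_cstar[OF u] Gamma0_fibre[OF f u] Gamma0_fibre[OF g u]] n
        by simp
      also have "\<dots> \<le> b_norm A (f u) * c"
        using cstar_algebra.norm_nonneg[OF fibre_cstar[OF u] Gamma0_fibre[OF f u]] c(2)[OF u]
        by (simp add: mult_left_mono)
      finally show ?thesis using u c(1) by (simp add: field_simps)
    qed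
    ultimately show "\<exists>K. compactin X K \<and>
        (\<forall>u\<in>topspace X. \<epsilon> \<le> b_norm A (b_mult A (f u) (g u)) \<longrightarrow> u \<in> K)"
      by blast
  qed
  then show ?thesis by (simp add: Gamma0_sel)
qed

text \<open>The scalar may vary over the base: constants give closure under scaling, and cut-off
  functions are what the density argument multiplies by.\<close>

lemma Gamma0_scale_fun:
  assumes f: "f \<in> cs_carrier (Gamma0 X A)" and c: "continuous_map X euclidean c"
    and M: "\<And>u. u \<in> topspace X \<Longrightarrow> cmod (c u) \<le> M"
  shows "(\<lambda>u\<in>topspace X. b_scale A (c u) (f u)) \<in> cs_carrier (Gamma0 X A)"
proof (rule Gamma0_I)
  show "continuous_map X (b_top A) (\<lambda>u. b_scale A (c u) (f u))"
    by (intro continuous_map_scale Gamma0_continuous f c)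
  fix u assume u: "u \<in> topspace X"
  show "b_scale A (c u) (f u) \<in> cs_carrier (fibre A u)"
    using cstar_algebra.scale_closed[OF fibre_cstar[OF u] Gamma0_fibre[OF f u]] by simp
next
  fix \<epsilon> :: real assume "\<epsilon> > 0"
  \<comment> \<open>\<open>max M 1\<close> keeps the divisor positive.\<close>
  let ?K = "{u \<in> topspace X. b_norm A (f u) \<ge> \<epsilon>/(max M 1)}"
  have "compactin X ?K"
    using f \<open>\<epsilon> > 0\<close> by (intro Gamma0_compact) auto
  moreover have "u \<in> ?K" if u: "u \<in> topspace X" and n: "\<epsilon> \<le> b_norm A (b_scale A (c u) (f u))" for u
  proof -
    have "\<epsilon> \<le> cmod (c u) * b_norm A (f u)"
      using cstar_algebra.norm_scale[OF fibre_cstar[OF u] Gamma0_fibre[OF f u], of "c u"] n by simp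
    also have "\<dots> \<le> max M 1 * b_norm A (f u)"
      using cstar_algebra.norm_nonneg[OF fibre_cstar[OF u] Gamma0_fibre[OF f u]] M[OF u]
      by (intro mult_right_mono) auto
    finally show ?thesis using u by (simp add: pos_divide_le_eq mult.commute)
  qed
  ultimately show "\<exists>K. compactin X K \<and>
      (\<forall>u\<in>topspace X. \<epsilon> \<le> b_norm A (b_scale A (c u) (f u)) \<longrightarrow> u \<in> K)"
    by blast
qed

lemma Gamma0_scale_closed:
  assumes "f \<in> cs_carrier (Gamma0 X A)"
  shows "cs_scale (Gamma0 X A) c f \<in> cs_carrier (Gamma0 X A)"
  using Gamma0_scale_fun[OF assms, of "\<lambda>_. c" "cmod c"] by (simp add: Gamma0_sel)

text \<open>The axioms do not state that the involution preserves the norm. The C*-identity for the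
  adjoint of a bounds the square of its norm by the product of both norms, and one factor
  cancels.\<close>

lemma fibre_norm_star:
  assumes "u \<in> topspace X" "a \<in> cs_carrier (fibre A u)"
  shows "b_norm A (b_star A a) \<le> b_norm A a"
proof -
  interpret F: cstar_algebra "fibre A u" by (rule fibre_cstar[OF assms(1)])
  have "(b_norm A (b_star A a))\<^sup>2 \<le> b_norm A a * b_norm A (b_star A a)"
    using F.cstar_identity[OF F.star_closed[OF assms(2)]] F.star_star[OF assms(2)]
      F.norm_mult[OF assms(2) F.star_closed[OF assms(2)]] by simp
  then show ?thesis
    using F.norm_nonneg[OF F.star_closed[OF assms(2)]] F.norm_nonneg[OF assms(2)]
    by (auto simp: power2_eq_square mult_le_cancel_right)
qed

lemma Gamma0_star_closed:
  assumes f: "f \<in> cs_carrier (Gamma0 X A)"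
  shows "cs_star (Gamma0 X A) f \<in> cs_carrier (Gamma0 X A)"
proof -
  have "(\<lambda>u\<in>topspace X. b_star A (f u)) \<in> cs_carrier (Gamma0 X A)"
  proof (rule Gamma0_I)
    show "continuous_map X (b_top A) (\<lambda>u. b_star A (f u))"
      using continuous_map_compose[OF Gamma0_continuous[OF f] star_continuous] by (simp add: o_def)
    fix u assume u: "u \<in> topspace X"
    show "b_star A (f u) \<in> cs_carrier (fibre A u)"
      using cstar_algebra.star_closed[OF fibre_cstar[OF u] Gamma0_fibre[OF f u]] by simp
  next
    fix \<epsilon> :: real assume "\<epsilon> > 0"
    then have "compactin X {u \<in> topspace X. b_norm A (f u) \<ge> \<epsilon>}"
      by (rule Gamma0_compact[OF f])
    moreover have "u \<in> {u \<in> topspace X. b_norm A (f u) \<ge> \<epsilon>}"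
      if u: "u \<in> topspace X" and n: "\<epsilon> \<le> b_norm A (b_star A (f u))" for u
      using fibre_norm_star[OF u Gamma0_fibre[OF f u]] u n by simp
    ultimately show "\<exists>K. compactin X K \<and>
        (\<forall>u\<in>topspace X. \<epsilon> \<le> b_norm A (b_star A (f u)) \<longrightarrow> u \<in> K)"
      by blast
  qed
  then show ?thesis by (simp add: Gamma0_sel)
qed

lemmas Gamma0_closed = Gamma0_zero_closed Gamma0_add_closed Gamma0_mult_closed
  Gamma0_scale_closed Gamma0_star_closed

section \<open>Metric, completeness and C*-axioms of the section algebra\<close>

lemma Gamma0_dist_upper:
  assumes f: "f \<in> cs_carrier (Gamma0 X A)" and g: "g \<in> cs_carrier (Gamma0 X A)"
    and u: "u \<in> topspace X"
  shows "cs_dist (fibre A u) (f u) (g u) \<le> cs_dist (Gamma0 X A) f g"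
  using Gamma0_norm_upper[OF Gamma0_add_closed[OF f Gamma0_scale_closed[OF g, of "-1"]] u] f g u
  by (simp add: cs_dist_def Gamma0_apply Gamma0_fibre del: fibre_sel)

text \<open>With \<open>Gamma0_dist_upper\<close> this makes the distance of two sections the least
  nonnegative bound of their fibrewise distances, so that metric statements can be checked fibre by
  fibre.\<close>

lemma Gamma0_dist_least:
  assumes f: "f \<in> cs_carrier (Gamma0 X A)" and g: "g \<in> cs_carrier (Gamma0 X A)"
    and c: "0 \<le> c" "\<And>u. u \<in> topspace X \<Longrightarrow> cs_dist (fibre A u) (f u) (g u) \<le> c"
  shows "cs_dist (Gamma0 X A) f g \<le> c"
proof -
  have "cs_norm (Gamma0 X A) (cs_add (Gamma0 X A) f (cs_scale (Gamma0 X A) (-1) g)) \<le> c"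
    using c f g by (intro Gamma0_norm_least)
      (simp_all add: cs_dist_def Gamma0_apply Gamma0_fibre del: fibre_sel)
  then show ?thesis using f g by (simp add: cs_dist_def)
qed

text \<open>The general \<open>cs_metric\<close> cannot be used yet: it presupposes
  \<open>cstar_algebra\<close>, whose completeness axiom is proved with the help of this
  metric.\<close>

lemma Gamma0_metric: "Metric_space (cs_carrier (Gamma0 X A)) (cs_dist (Gamma0 X A))"
proof -
  note fm = cstar_algebra.cs_metric[OF fibre_cstar]
  have nn: "0 \<le> cs_dist (Gamma0 X A) f g" for f g
    by (simp add: cs_dist_def Gamma0_norm_nonneg Gamma0_closed)
  have le: "cs_dist (Gamma0 X A) f g \<le> cs_dist (Gamma0 X A) g f" for f g
  proof (cases "f \<in> cs_carrier (Gamma0 X A) \<and> g \<in> cs_carrier (Gamma0 X A)")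
    case True
    then show ?thesis
      by (intro Gamma0_dist_least nn)
        (auto simp: Gamma0_dist_upper Metric_space.commute[OF fm, of _ "f _" "g _"])
  qed (auto simp: cs_dist_def)
  show ?thesis
  proof
    show "0 \<le> cs_dist (Gamma0 X A) f g" for f g by (rule nn)
    show "cs_dist (Gamma0 X A) f g = cs_dist (Gamma0 X A) g f" for f g
      using le[of f g] le[of g f] by simp
    fix f g assume f: "f \<in> cs_carrier (Gamma0 X A)" and g: "g \<in> cs_carrier (Gamma0 X A)"
    show "cs_dist (Gamma0 X A) f g = 0 \<longleftrightarrow> f = g"
    proof
      assume 0: "cs_dist (Gamma0 X A) f g = 0"
      show "f = g"
      proof (rule Gamma0_eqI[OF f g])
        fix u assume u: "u \<in> topspace X"
        have "cs_dist (fibre A u) (f u) (g u) = 0"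
          using Gamma0_dist_upper[OF f g u] 0 Metric_space.nonneg[OF fm[OF u], of "f u" "g u"] by simp
        then show "f u = g u"
          using Metric_space.zero[OF fm[OF u] Gamma0_fibre[OF f u] Gamma0_fibre[OF g u]] by simp
      qed
    next
      assume "f = g"
      then have "cs_dist (Gamma0 X A) f g \<le> 0"
        using f g by (intro Gamma0_dist_least) (auto simp: Metric_space.mdist_zero[OF fm] Gamma0_fibre)
      then show "cs_dist (Gamma0 X A) f g = 0" using nn[of f g] by simp
    qed
    fix h assume h: "h \<in> cs_carrier (Gamma0 X A)"
    show "cs_dist (Gamma0 X A) f h \<le> cs_dist (Gamma0 X A) f g + cs_dist (Gamma0 X A) g h"
    proof (rule Gamma0_dist_least[OF f h])
      fix u assume u: "u \<in> topspace X"
      show "cs_dist (fibre A u) (f u) (h u) \<le> cs_dist (Gamma0 X A) f g + cs_dist (Gamma0 X A) g h"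
        using Metric_space.triangle[OF fm[OF u] Gamma0_fibre[OF f u] Gamma0_fibre[OF g u] Gamma0_fibre[OF h u]]
          Gamma0_dist_upper[OF f g u] Gamma0_dist_upper[OF g h u] by simp
    qed (simp add: nn)
  qed
qed

text \<open>Each fibre is complete, so a Cauchy sequence converges in every fibre. The Cauchy
  estimate is uniform over the base and survives the limit, so the convergence is uniform;
  continuity of the limit is then \<open>continuous_section_uniform_limit\<close>.\<close>

lemma Gamma0_complete: "Metric_space.mcomplete (cs_carrier (Gamma0 X A)) (cs_dist (Gamma0 X A))"
  unfolding Metric_space.mcomplete_def[OF Gamma0_metric]
proof (intro allI impI)
  interpret M: Metric_space "cs_carrier (Gamma0 X A)" "cs_dist (Gamma0 X A)"
    by (rule Gamma0_metric)
  note fm = cstar_algebra.cs_metric[OF fibre_cstar]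
  fix \<sigma> assume \<sigma>: "M.MCauchy \<sigma>"
  have \<sigma>G: "\<sigma> n \<in> cs_carrier (Gamma0 X A)" for n
    using \<sigma> unfolding M.MCauchy_def by auto
  have "\<exists>l. limitin (Metric_space.mtopology (cs_carrier (fibre A u)) (cs_dist (fibre A u)))
      (\<lambda>n. \<sigma> n u) l sequentially" if u: "u \<in> topspace X" for u
  proof -
    have "Metric_space.MCauchy (cs_carrier (fibre A u)) (cs_dist (fibre A u)) (\<lambda>n. \<sigma> n u)"
      using \<sigma> \<sigma>G Gamma0_dist_upper[OF \<sigma>G \<sigma>G u]
      unfolding M.MCauchy_def Metric_space.MCauchy_def[OF fm[OF u]]
      by (auto simp: Gamma0_fibre u) (meson le_less_trans)
    then show ?thesis
      using cstar_algebra.complete[OF fibre_cstar[OF u]]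
      unfolding Metric_space.mcomplete_def[OF fm[OF u]] by blast
  qed
  then obtain l where l: "\<And>u. u \<in> topspace X \<Longrightarrow>
      limitin (Metric_space.mtopology (cs_carrier (fibre A u)) (cs_dist (fibre A u)))
        (\<lambda>n. \<sigma> n u) (l u) sequentially"
    by metis
  have lF: "l u \<in> cs_carrier (fibre A u)" if "u \<in> topspace X" for u
    using l[OF that] by (simp add: Metric_space.limitin_metric[OF fm[OF that]])
  have unif: "\<exists>N. \<forall>n\<ge>N. \<forall>u\<in>topspace X. cs_dist (fibre A u) (l u) (\<sigma> n u) \<le> \<epsilon>" if "\<epsilon> > 0" for \<epsilon>
  proof -
    obtain N where N: "\<And>n m. \<lbrakk>N \<le> n; N \<le> m\<rbrakk> \<Longrightarrow> cs_dist (Gamma0 X A) (\<sigma> n) (\<sigma> m) < \<epsilon>"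
      using \<sigma> \<open>\<epsilon> > 0\<close> unfolding M.MCauchy_def by blast
    have "cs_dist (fibre A u) (l u) (\<sigma> n u) \<le> \<epsilon>" if n: "N \<le> n" and u: "u \<in> topspace X" for n u
    \<comment> \<open>The limit is reached through a later index, which may depend on u and \<eta>;
      letting \<eta> tend to 0 removes this dependence and leaves an N valid for all u.\<close>
    proof (rule field_le_epsilon)
      fix \<eta> :: real assume "\<eta> > 0"
      interpret F: Metric_space "cs_carrier (fibre A u)" "cs_dist (fibre A u)" by (rule fm[OF u])
      obtain M where "\<And>m. M \<le> m \<Longrightarrow> cs_dist (fibre A u) (\<sigma> m u) (l u) < \<eta>"
        using l[OF u] \<open>\<eta> > 0\<close> unfolding F.limitin_metric eventually_sequentially by blast
      then have 1: "cs_dist (fibre A u) (\<sigma> (max M N) u) (l u) < \<eta>" by simp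
      have 2: "cs_dist (fibre A u) (\<sigma> n u) (\<sigma> (max M N) u) < \<epsilon>"
        using Gamma0_dist_upper[OF \<sigma>G \<sigma>G u, of n "max M N"] N[OF n, of "max M N"] by simp
      show "cs_dist (fibre A u) (l u) (\<sigma> n u) \<le> \<epsilon> + \<eta>"
        using F.triangle[of "\<sigma> n u" "\<sigma> (max M N) u" "l u"] 1 2 lF[OF u] Gamma0_fibre[OF \<sigma>G u]
        by (simp add: F.commute)
    qed
    then show ?thesis by blast
  qed
  have "restrict l (topspace X) \<in> cs_carrier (Gamma0 X A)"
  proof (rule Gamma0_I)
    show "continuous_map X (b_top A) l"
    proof (rule continuous_section_uniform_limit[OF lF])
      fix \<epsilon> :: real assume "\<epsilon> > 0"
      then obtain n where "\<And>u. u \<in> topspace X \<Longrightarrow> cs_dist (fibre A u) (l u) (\<sigma> n u) \<le> \<epsilon>/2"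
        using unif[of "\<epsilon>/2"] by auto
      then show "\<exists>g. continuous_map X (b_top A) g \<and> (\<forall>u\<in>topspace X. g u \<in> cs_carrier (fibre A u)
          \<and> cs_dist (fibre A u) (l u) (g u) < \<epsilon>)"
        using \<open>\<epsilon> > 0\<close> \<sigma>G Gamma0_continuous Gamma0_fibre
        by (intro exI[of _ "\<sigma> n"]) (force intro: le_less_trans)
    qed
    show "l u \<in> cs_carrier (fibre A u)" if "u \<in> topspace X" for u by (rule lF[OF that])
    fix \<epsilon> :: real assume "\<epsilon> > 0"
    then obtain n where n: "\<And>u. u \<in> topspace X \<Longrightarrow> cs_dist (fibre A u) (l u) (\<sigma> n u) \<le> \<epsilon>/2"
      using unif[of "\<epsilon>/2"] by auto
    \<comment> \<open>Where the limit has norm at least \<epsilon>, an approximant within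
      \<epsilon>/2 has norm at least \<epsilon>/2, so the compact set belonging to that single
      approximant serves.\<close>
    have "u \<in> {u \<in> topspace X. \<epsilon>/2 \<le> b_norm A (\<sigma> n u)}"
      if u: "u \<in> topspace X" and \<epsilon>: "\<epsilon> \<le> b_norm A (l u)" for u
    proof -
      interpret F: cstar_algebra "fibre A u" by (rule fibre_cstar[OF u])
      have "b_norm A (l u) \<le> cs_dist (fibre A u) (l u) (\<sigma> n u) + b_norm A (\<sigma> n u)"
        using Metric_space.triangle[OF F.cs_metric lF[OF u] Gamma0_fibre[OF \<sigma>G u, of n] F.zero_closed]
          F.cs_dist_zero[OF lF[OF u]] F.cs_dist_zero[OF Gamma0_fibre[OF \<sigma>G u]] by simp
      then show ?thesis using n[OF u] \<epsilon> u by simp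
    qed
    then show "\<exists>K. compactin X K \<and> (\<forall>u\<in>topspace X. \<epsilon> \<le> b_norm A (l u) \<longrightarrow> u \<in> K)"
      using Gamma0_compact[OF \<sigma>G[of n], of "\<epsilon>/2"] \<open>\<epsilon> > 0\<close> by fastforce
  qed
  moreover have "\<exists>N. \<forall>n\<ge>N. cs_dist (Gamma0 X A) (\<sigma> n) (restrict l (topspace X)) < \<epsilon>" if "\<epsilon> > 0" for \<epsilon>
  proof -
    obtain N where N: "\<And>n u. \<lbrakk>N \<le> n; u \<in> topspace X\<rbrakk> \<Longrightarrow> cs_dist (fibre A u) (l u) (\<sigma> n u) \<le> \<epsilon>/2"
      using unif[of "\<epsilon>/2"] \<open>\<epsilon> > 0\<close> by auto
    have "cs_dist (Gamma0 X A) (restrict l (topspace X)) (\<sigma> n) < \<epsilon>" if "N \<le> n" for n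
      using Gamma0_dist_least[OF calculation \<sigma>G[of n], of "\<epsilon>/2"] N[OF that] \<open>\<epsilon> > 0\<close> by simp
    then show ?thesis by (auto simp: M.commute)
  qed
  ultimately have "limitin M.mtopology \<sigma> (restrict l (topspace X)) sequentially"
    unfolding M.limitin_metric eventually_sequentially using \<sigma>G by blast
  then show "\<exists>x. limitin M.mtopology \<sigma> x sequentially" by blast
qed

lemma Gamma0_cstar_algebra: "cstar_algebra (Gamma0 X A)"
proof
  note [simp] = Gamma0_closed Gamma0_apply Gamma0_fibre
  note [simp del] = fibre_sel
  let ?\<Gamma> = "Gamma0 X A"
  fix f assume f: "f \<in> cs_carrier ?\<Gamma>"
  show "cs_add ?\<Gamma> (cs_zero ?\<Gamma>) f = f"
    using f by (intro Gamma0_eqI) (simp_all add: cstar_algebra.add_zero[OF fibre_cstar])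
  show "cs_scale ?\<Gamma> 1 f = f"
    using f by (intro Gamma0_eqI) (simp_all add: cstar_algebra.scale_one[OF fibre_cstar])
  show "cs_star ?\<Gamma> (cs_star ?\<Gamma> f) = f"
    using f by (intro Gamma0_eqI) (simp_all add: cstar_algebra.star_star[OF fibre_cstar])
  have "cs_add ?\<Gamma> f (cs_scale ?\<Gamma> (-1) f) = cs_zero ?\<Gamma>"
    using f by (intro Gamma0_eqI) (simp_all add: cstar_algebra.add_minus[OF fibre_cstar])
  then show "\<exists>g\<in>cs_carrier ?\<Gamma>. cs_add ?\<Gamma> f g = cs_zero ?\<Gamma>"
    using f by (meson Gamma0_scale_closed)
  show "0 \<le> cs_norm ?\<Gamma> f" by (rule Gamma0_norm_nonneg[OF f])
  show "cs_norm ?\<Gamma> f = 0 \<longleftrightarrow> f = cs_zero ?\<Gamma>"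
  proof
    assume 0: "cs_norm ?\<Gamma> f = 0"
    show "f = cs_zero ?\<Gamma>"
    proof (rule Gamma0_eqI)
      fix u assume u: "u \<in> topspace X"
      then have "cs_norm (fibre A u) (f u) = 0"
        using Gamma0_norm_upper[OF f u] 0 f cstar_algebra.norm_nonneg[OF fibre_cstar[OF u], of "f u"]
        by simp
      then show "f u = cs_zero ?\<Gamma> u"
        using u f by (simp add: cstar_algebra.norm_eq_zero[OF fibre_cstar])
    qed (simp_all add: f)
  next
    assume "f = cs_zero ?\<Gamma>"
    then have "cs_norm ?\<Gamma> f \<le> 0"
      by (intro Gamma0_norm_least) (simp_all add: cstar_algebra.norm_zero[OF fibre_cstar])
    then show "cs_norm ?\<Gamma> f = 0" using Gamma0_norm_nonneg[OF f] by simp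
  qed
  show "cs_norm ?\<Gamma> (cs_mult ?\<Gamma> (cs_star ?\<Gamma> f) f) = (cs_norm ?\<Gamma> f)\<^sup>2"
  proof (rule antisym)
    show "cs_norm ?\<Gamma> (cs_mult ?\<Gamma> (cs_star ?\<Gamma> f) f) \<le> (cs_norm ?\<Gamma> f)\<^sup>2"
      using f Gamma0_norm_upper[OF f]
      by (intro Gamma0_norm_least)
        (simp_all add: cstar_algebra.cstar_identity[OF fibre_cstar] power_mono
          cstar_algebra.norm_nonneg[OF fibre_cstar])
    \<comment> \<open>The lower estimate is recast as an upper bound for the norm of f, which can be
      tested fibrewise with the C*-identity of each fibre.\<close>
    have "cs_norm ?\<Gamma> f \<le> sqrt (cs_norm ?\<Gamma> (cs_mult ?\<Gamma> (cs_star ?\<Gamma> f) f))"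
    proof (rule Gamma0_norm_least)
      fix u assume u: "u \<in> topspace X"
      show "cs_norm (fibre A u) (f u) \<le> sqrt (cs_norm ?\<Gamma> (cs_mult ?\<Gamma> (cs_star ?\<Gamma> f) f))"
        using Gamma0_norm_upper[of "cs_mult ?\<Gamma> (cs_star ?\<Gamma> f) f" u] u f
        by (intro real_le_rsqrt) (simp add: cstar_algebra.cstar_identity[OF fibre_cstar])
    qed (simp add: f Gamma0_norm_nonneg)
    then show "(cs_norm ?\<Gamma> f)\<^sup>2 \<le> cs_norm ?\<Gamma> (cs_mult ?\<Gamma> (cs_star ?\<Gamma> f) f)"
      using f by (metis Gamma0_norm_nonneg real_le_rsqrt sqrt_le_D power_mono
          real_sqrt_pow2 Gamma0_mult_closed Gamma0_star_closed)
  qed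
  fix c :: complex
  show "cs_star ?\<Gamma> (cs_scale ?\<Gamma> c f) = cs_scale ?\<Gamma> (cnj c) (cs_star ?\<Gamma> f)"
    using f by (intro Gamma0_eqI) (simp_all add: cstar_algebra.star_scale[OF fibre_cstar])
  \<comment> \<open>Only this inequality is checked fibrewise. For nonzero c, the same inequality
    for the inverse scalar gives the converse; hence it is stated for all f and c.\<close>
  have scale_le: "cs_norm ?\<Gamma> (cs_scale ?\<Gamma> c f) \<le> cmod c * cs_norm ?\<Gamma> f"
    if f: "f \<in> cs_carrier ?\<Gamma>" for f c
    using f Gamma0_norm_upper[OF f]
    by (intro Gamma0_norm_least)
      (simp_all add: cstar_algebra.norm_scale[OF fibre_cstar] mult_left_mono Gamma0_norm_nonneg)
  show "cs_norm ?\<Gamma> (cs_scale ?\<Gamma> c f) = cmod c * cs_norm ?\<Gamma> f"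
  proof (cases "c = 0")
    case True
    then show ?thesis
      using scale_le[OF f, of c] Gamma0_norm_nonneg[OF Gamma0_scale_closed[OF f, of c]] by simp
  next
    case False
    have "cs_scale ?\<Gamma> (inverse c) (cs_scale ?\<Gamma> c f) = f"
      using f False by (intro Gamma0_eqI)
        (simp_all add: cstar_algebra.scale_scale[OF fibre_cstar] cstar_algebra.scale_one[OF fibre_cstar])
    then have "cs_norm ?\<Gamma> f \<le> cmod (inverse c) * cs_norm ?\<Gamma> (cs_scale ?\<Gamma> c f)"
      using scale_le[OF Gamma0_scale_closed[OF f], of "inverse c" c] by simp
    then show ?thesis
      using scale_le[OF f, of c] False by (simp add: norm_divide field_simps)
  qed
  fix a
  show "cs_scale ?\<Gamma> a (cs_scale ?\<Gamma> c f) = cs_scale ?\<Gamma> (a * c) f"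
    using f by (intro Gamma0_eqI) (simp_all add: cstar_algebra.scale_scale[OF fibre_cstar])
  show "cs_scale ?\<Gamma> (a + c) f = cs_add ?\<Gamma> (cs_scale ?\<Gamma> a f) (cs_scale ?\<Gamma> c f)"
    using f by (intro Gamma0_eqI) (simp_all add: cstar_algebra.scale_add_left[OF fibre_cstar])
next
  note [simp] = Gamma0_closed Gamma0_apply Gamma0_fibre
  note [simp del] = fibre_sel
  let ?\<Gamma> = "Gamma0 X A"
  fix f g assume f: "f \<in> cs_carrier ?\<Gamma>" and g: "g \<in> cs_carrier ?\<Gamma>"
  show "cs_add ?\<Gamma> f g = cs_add ?\<Gamma> g f"
    using f g by (intro Gamma0_eqI) (simp_all add: cstar_algebra.add_commute[OF fibre_cstar, of _ "f _" "g _"])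
  show "cs_star ?\<Gamma> (cs_add ?\<Gamma> f g) = cs_add ?\<Gamma> (cs_star ?\<Gamma> f) (cs_star ?\<Gamma> g)"
    using f g by (intro Gamma0_eqI) (simp_all add: cstar_algebra.star_add[OF fibre_cstar])
  show "cs_star ?\<Gamma> (cs_mult ?\<Gamma> f g) = cs_mult ?\<Gamma> (cs_star ?\<Gamma> g) (cs_star ?\<Gamma> f)"
    using f g by (intro Gamma0_eqI) (simp_all add: cstar_algebra.star_mult[OF fibre_cstar])
  show "cs_norm ?\<Gamma> (cs_add ?\<Gamma> f g) \<le> cs_norm ?\<Gamma> f + cs_norm ?\<Gamma> g"
  proof (rule Gamma0_norm_least)
    fix u assume u: "u \<in> topspace X"
    show "cs_norm (fibre A u) (cs_add ?\<Gamma> f g u) \<le> cs_norm ?\<Gamma> f + cs_norm ?\<Gamma> g"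
      using cstar_algebra.norm_triangle[OF fibre_cstar[OF u], of "f u" "g u"] f g u
        Gamma0_norm_upper[OF f u] Gamma0_norm_upper[OF g u] by simp
  qed (simp add: f g Gamma0_norm_nonneg)
  show "cs_norm ?\<Gamma> (cs_mult ?\<Gamma> f g) \<le> cs_norm ?\<Gamma> f * cs_norm ?\<Gamma> g"
  proof (rule Gamma0_norm_least)
    fix u assume u: "u \<in> topspace X"
    have "cs_norm (fibre A u) (f u) * cs_norm (fibre A u) (g u) \<le> cs_norm ?\<Gamma> f * cs_norm ?\<Gamma> g"
      using f g u by (intro mult_mono Gamma0_norm_upper Gamma0_norm_nonneg)
        (simp_all add: cstar_algebra.norm_nonneg[OF fibre_cstar])
    then show "cs_norm (fibre A u) (cs_mult ?\<Gamma> f g u) \<le> cs_norm ?\<Gamma> f * cs_norm ?\<Gamma> g"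
      using cstar_algebra.norm_mult[OF fibre_cstar[OF u], of "f u" "g u"] f g u by simp
  qed (simp add: f g Gamma0_norm_nonneg)
  fix c
  show "cs_scale ?\<Gamma> c (cs_add ?\<Gamma> f g) = cs_add ?\<Gamma> (cs_scale ?\<Gamma> c f) (cs_scale ?\<Gamma> c g)"
    using f g by (intro Gamma0_eqI) (simp_all add: cstar_algebra.scale_add_right[OF fibre_cstar])
  show "cs_mult ?\<Gamma> (cs_scale ?\<Gamma> c f) g = cs_scale ?\<Gamma> c (cs_mult ?\<Gamma> f g)"
    using f g by (intro Gamma0_eqI) (simp_all add: cstar_algebra.mult_scale_left[OF fibre_cstar])
  show "cs_mult ?\<Gamma> f (cs_scale ?\<Gamma> c g) = cs_scale ?\<Gamma> c (cs_mult ?\<Gamma> f g)"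
    using f g by (intro Gamma0_eqI) (simp_all add: cstar_algebra.mult_scale_right[OF fibre_cstar])
next
  note [simp] = Gamma0_closed Gamma0_apply Gamma0_fibre
  note [simp del] = fibre_sel
  let ?\<Gamma> = "Gamma0 X A"
  fix f g h assume f: "f \<in> cs_carrier ?\<Gamma>" and g: "g \<in> cs_carrier ?\<Gamma>" and h: "h \<in> cs_carrier ?\<Gamma>"
  show "cs_add ?\<Gamma> (cs_add ?\<Gamma> f g) h = cs_add ?\<Gamma> f (cs_add ?\<Gamma> g h)"
    using f g h by (intro Gamma0_eqI) (simp_all add: cstar_algebra.add_assoc[OF fibre_cstar])
  show "cs_mult ?\<Gamma> (cs_mult ?\<Gamma> f g) h = cs_mult ?\<Gamma> f (cs_mult ?\<Gamma> g h)"
    using f g h by (intro Gamma0_eqI) (simp_all add: cstar_algebra.mult_assoc[OF fibre_cstar])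
  show "cs_mult ?\<Gamma> (cs_add ?\<Gamma> f g) h = cs_add ?\<Gamma> (cs_mult ?\<Gamma> f h) (cs_mult ?\<Gamma> g h)"
    using f g h by (intro Gamma0_eqI) (simp_all add: cstar_algebra.mult_add_left[OF fibre_cstar])
  show "cs_mult ?\<Gamma> f (cs_add ?\<Gamma> g h) = cs_add ?\<Gamma> (cs_mult ?\<Gamma> f g) (cs_mult ?\<Gamma> f h)"
    using f g h by (intro Gamma0_eqI) (simp_all add: cstar_algebra.mult_add_right[OF fibre_cstar])
qed (simp_all add: Gamma0_closed Gamma0_complete)

section \<open>Sections vanishing off a set, and extension by zero\<close>

lemma Gamma0_on_closed_ideal: "closed_ideal (Gamma0 X A) (Gamma0_on X A e)"
proof -
  let ?\<Gamma> = "Gamma0 X A"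
  interpret \<Gamma>: cstar_algebra ?\<Gamma> by (rule Gamma0_cstar_algebra)
  interpret M: Metric_space "cs_carrier ?\<Gamma>" "cs_dist ?\<Gamma>" by (rule \<Gamma>.cs_metric)
  note fz = cstar_algebra.add_zero[OF fibre_cstar] cstar_algebra.scale_zero_right[OF fibre_cstar]
    cstar_algebra.mult_zero_left[OF fibre_cstar] cstar_algebra.mult_zero_right[OF fibre_cstar]
    cstar_algebra.zero_closed[OF fibre_cstar]
  have zero: "b_zero A u = cs_zero (fibre A u)" for u by simp
  have "cs_subspace ?\<Gamma> (Gamma0_on X A e)"
    unfolding cs_subspace_def Gamma0_on_def zero
    by (auto simp: Gamma0_closed Gamma0_apply fz simp del: fibre_sel)
  moreover have "cs_mult ?\<Gamma> b f \<in> Gamma0_on X A e \<and> cs_mult ?\<Gamma> f b \<in> Gamma0_on X A e"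
    if "f \<in> Gamma0_on X A e" "b \<in> cs_carrier ?\<Gamma>" for f b
    using that unfolding Gamma0_on_def zero
    by (auto simp: Gamma0_closed Gamma0_apply Gamma0_fibre fz simp del: fibre_sel)
  moreover have "closedin (cs_topology ?\<Gamma>) (Gamma0_on X A e)"
    unfolding cs_topology_def M.closedin_metric
  proof (intro conjI allI impI)
    show "Gamma0_on X A e \<subseteq> cs_carrier ?\<Gamma>" by (auto simp: Gamma0_on_def)
    fix f assume "f \<in> cs_carrier ?\<Gamma> - Gamma0_on X A e"
    then obtain u where f: "f \<in> cs_carrier ?\<Gamma>" and u: "u \<in> topspace X - e" "f u \<noteq> b_zero A u"
      by (auto simp: Gamma0_on_def)
    interpret F: cstar_algebra "fibre A u" using u by (intro fibre_cstar) simp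
    have fu: "f u \<in> cs_carrier (fibre A u)" using f u Gamma0_fibre by simp
    \<comment> \<open>This norm is the radius of a ball around f that misses the ideal: a section
      vanishing at u is at least that far from f already in the fibre at u.\<close>
    have "b_norm A (f u) > 0"
      using F.norm_eq_zero[OF fu] F.norm_nonneg[OF fu] u by simp
    moreover have "g \<notin> M.mball f (b_norm A (f u))" if "g \<in> Gamma0_on X A e" for g
    proof
      assume "g \<in> M.mball f (b_norm A (f u))"
      then have "cs_dist ?\<Gamma> f g < b_norm A (f u)" "g \<in> cs_carrier ?\<Gamma>" by simp_all
      moreover have "g u = b_zero A u" using that u by (simp add: Gamma0_on_def)
      ultimately show False
        using Gamma0_dist_upper[OF f, of g u] u F.cs_dist_zero[OF fu] by simp
    qed
    ultimately show "\<exists>r>0. disjnt (Gamma0_on X A e) (M.mball f r)"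
      unfolding disjnt_iff by blast
  qed
  ultimately show ?thesis by (simp add: closed_ideal_def)
qed

lemma Gamma0_on_star:
  assumes "f \<in> Gamma0_on X A e"
  shows "cs_star (Gamma0 X A) f \<in> Gamma0_on X A e"
proof -
  have "b_zero A u = cs_zero (fibre A u)" for u by simp
  then show ?thesis
    using assms unfolding Gamma0_on_def
    by (simp add: Gamma0_closed Gamma0_apply cstar_algebra.star_zero[OF fibre_cstar] del: fibre_sel)
qed

text \<open>At a point outside U, take the compact K that belongs to the radius \<delta> of
  \<open>zero_nbhd\<close>. It is closed because X is Hausdorff, and it misses the point because it
  lies in U. Removing it leaves a neighbourhood on which h is small enough to stay near
  zero.\<close>

lemma Gamma0_glue:
  assumes U: "openin X U" and cont: "continuous_map (subtopology X U) (b_top A) h"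
    and fib: "\<And>u. u \<in> topspace X \<Longrightarrow> h u \<in> cs_carrier (fibre A u)"
    and off: "\<And>u. u \<in> topspace X - U \<Longrightarrow> h u = b_zero A u"
    and K: "\<And>\<epsilon>. \<epsilon> > 0 \<Longrightarrow> \<exists>K. compactin X K \<and> K \<subseteq> U \<and> (\<forall>u\<in>topspace X. \<epsilon> \<le> b_norm A (h u) \<longrightarrow> u \<in> K)"
  shows "restrict h (topspace X) \<in> cs_carrier (Gamma0 X A)"
proof (rule Gamma0_I[OF _ fib])
  show "continuous_map X (b_top A) h"
  proof (rule continuous_mapI_nbhd)
    show "h u \<in> topspace (b_top A)" if "u \<in> topspace X" for u
      using fib[OF that] by (simp add: fibre_carrier_iff)
    fix u V assume u: "u \<in> topspace X" and V: "openin (b_top A) V" "h u \<in> V"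
    show "\<exists>W. openin X W \<and> u \<in> W \<and> (\<forall>v\<in>W. h v \<in> V)"
    proof (cases "u \<in> U")
      case True
      have "openin (subtopology X U) {v \<in> topspace (subtopology X U). h v \<in> V}"
        using openin_continuous_map_preimage[OF cont V(1)] .
      then have "openin X {v \<in> topspace (subtopology X U). h v \<in> V}"
        using U openin_trans_full by blast
      then show ?thesis using True u V(2) by force
    next
      case False
      then have "b_zero A u \<in> V" using off u V(2) by auto
      then obtain W \<delta> where W: "openin X W" "u \<in> W" "\<delta> > 0"
        "\<And>b. \<lbrakk>b \<in> topspace (b_top A); b_proj A b \<in> W; b_norm A b < \<delta>\<rbrakk> \<Longrightarrow> b \<in> V"
        using zero_nbhd[OF u V(1)] by blast
      obtain K where K: "compactin X K" "K \<subseteq> U" "\<And>v. \<lbrakk>v \<in> topspace X; \<delta> \<le> b_norm A (h v)\<rbrakk> \<Longrightarrow> v \<in> K"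
        using K[OF W(3)] by blast
      have "openin X (W - K)"
        using W(1) compactin_imp_closedin[OF base_Hausdorff K(1)] by (rule openin_diff)
      moreover have "h v \<in> V" if "v \<in> W - K" for v
      proof -
        have v: "v \<in> topspace X" using that openin_subset[OF W(1)] by blast
        then have "b_norm A (h v) < \<delta>" using K(3) that by force
        then show ?thesis
          using W(4)[of "h v"] fib[OF v] that by (simp add: fibre_carrier_iff)
      qed
      ultimately show ?thesis using W(2) False K(2) by blast
    qed
  qed
  fix \<epsilon> :: real assume "\<epsilon> > 0"
  then show "\<exists>K. compactin X K \<and> (\<forall>u\<in>topspace X. \<epsilon> \<le> b_norm A (h u) \<longrightarrow> u \<in> K)"
    by (rule ex_forward[OF K]) simp
qed

end

section \<open>Groupoids and open G-sets\<close>

context groupoid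
begin

lemma d_inv: "x \<in> g_carrier G \<Longrightarrow> g_d G (g_inv G x) = g_r G x"
  by (simp add: g_d_def g_r_def g_inv_inv)

lemma r_inv: "x \<in> g_carrier G \<Longrightarrow> g_r G (g_inv G x) = g_d G x"
  by (simp add: g_d_def g_r_def g_inv_inv)

lemma r_closed: "x \<in> g_carrier G \<Longrightarrow> g_r G x \<in> g_carrier G"
  unfolding g_r_def[of G x] by (rule g_mult_closed) (simp_all add: g_inv_closed r_inv)

lemma r_r: "x \<in> g_carrier G \<Longrightarrow> g_r G (g_r G x) = g_r G x"
  using g_r_mult[of x "g_inv G x"] by (simp add: g_inv_closed r_inv flip: g_r_def)

lemma d_r: "x \<in> g_carrier G \<Longrightarrow> g_d G (g_r G x) = g_r G x"
  using g_d_mult[of x "g_inv G x"] by (simp add: g_inv_closed r_inv d_inv flip: g_r_def)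

lemma unit_iff: "u \<in> g_units G \<longleftrightarrow> u \<in> g_carrier G \<and> g_r G u = u"
  unfolding g_units_def using r_closed r_r by force

lemma d_unit: "u \<in> g_units G \<Longrightarrow> g_d G u = u"
  using d_r[of u] by (simp add: unit_iff)

lemma r_in_units: "x \<in> g_carrier G \<Longrightarrow> g_r G x \<in> g_units G"
  by (simp add: g_units_def)

lemma d_in_units: "x \<in> g_carrier G \<Longrightarrow> g_d G x \<in> g_units G"
  using r_in_units[OF g_inv_closed] by (simp add: r_inv)

text \<open>The unit laws are not among the groupoid axioms; this one is right cancellation for x
  and its inverse.\<close>

lemma r_mult_self: "x \<in> g_carrier G \<Longrightarrow> g_mult G (g_r G x) x = x"
  using g_cancel_right[of x "g_inv G x"] by (simp add: g_inv_closed r_inv g_inv_inv flip: g_r_def)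

lemma units_domain:
  assumes "e \<subseteq> g_units G"
  shows "g_d G ` e = e"
proof -
  have "g_d G ` e = id ` e"
    using assms d_unit by (intro image_cong) auto
  then show ?thesis by simp
qed

lemma units_topspace: "topspace (unit_space G) = g_units G"
  by (auto simp: unit_space_def unit_iff)

lemma left_cancel_unit:
  assumes "x \<in> g_carrier G" "y \<in> g_carrier G" "g_d G x = g_r G y" "g_mult G x y = x"
  shows "y = g_d G x"
  using g_cancel_left[OF assms(1-3)] assms(4) by (simp add: g_d_def)

end

lemma local_homeomorphism_continuous:
  assumes "local_homeomorphism X Y f"
  shows "continuous_map X Y f"
  unfolding continuous_map_def
proof (intro conjI allI impI)
  show "f \<in> topspace X \<rightarrow> topspace Y" using assms by (simp add: local_homeomorphism_def)
  fix V assume V: "openin Y V"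
  show "openin X {x \<in> topspace X. f x \<in> V}"
  proof (subst openin_subopen, clarify)
    fix x assume x: "x \<in> topspace X" "f x \<in> V"
    then obtain U where U: "openin X U" "x \<in> U"
      "homeomorphic_map (subtopology X U) (subtopology Y (f ` U)) f"
      using assms unfolding local_homeomorphism_def by blast
    have "continuous_map (subtopology X U) Y f"
      using homeomorphic_imp_continuous_map[OF U(3)] by (simp add: continuous_map_in_subtopology)
    then have "openin (subtopology X U) {y \<in> topspace (subtopology X U). f y \<in> V}"
      using V by (rule openin_continuous_map_preimage)
    then have "openin X {y \<in> topspace (subtopology X U). f y \<in> V}"
      using U(1) openin_trans_full by blast
    then show "\<exists>T. openin X T \<and> x \<in> T \<and> T \<subseteq> {x \<in> topspace X. f x \<in> V}"
      using x U by (intro exI[of _ "{y \<in> topspace (subtopology X U). f y \<in> V}"]) (simp, blast)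
  qed
qed

lemma local_homeomorphism_open:
  assumes "local_homeomorphism X Y f"
  shows "open_map X Y f"
  unfolding open_map_def
proof (intro allI impI)
  fix W assume W: "openin X W"
  show "openin Y (f ` W)"
  proof (subst openin_subopen, clarify)
    fix x assume x: "x \<in> W"
    then have "x \<in> topspace X" using W openin_subset by blast
    then obtain U where U: "openin X U" "x \<in> U" "openin Y (f ` U)"
      "homeomorphic_map (subtopology X U) (subtopology Y (f ` U)) f"
      using assms unfolding local_homeomorphism_def by blast
    have "openin (subtopology X U) (U \<inter> W)"
      using W by (auto simp: openin_subtopology)
    then have "openin (subtopology Y (f ` U)) (f ` (U \<inter> W))"
      using homeomorphic_imp_open_map[OF U(4)] by (simp add: open_map_def)
    then have "openin Y (f ` (U \<inter> W))"
      using U(3) openin_trans_full by blast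
    then show "\<exists>T. openin Y T \<and> f x \<in> T \<and> T \<subseteq> f ` W"
      using x U by (intro exI conjI) auto
  qed
qed

section \<open>Algebra of G-sets\<close>

lemma gset_at_eq:
  assumes "s \<in> open_gsets G" "x \<in> s"
  shows "gset_at G (g_r G x) s = x"
  unfolding gset_at_def using assms by (auto simp: open_gsets_def dest: inj_onD)

lemma gset_at_in:
  assumes "s \<in> open_gsets G" "u \<in> g_r G ` s"
  shows "gset_at G u s \<in> s" "g_r G (gset_at G u s) = u"
  using assms gset_at_eq by fastforce+

lemma open_gsets_sub: "s \<in> open_gsets G \<Longrightarrow> s \<subseteq> g_carrier G"
  by (simp add: open_gsets_def openin_subset)

lemma gset_mult_iff:
  "z \<in> gset_mult G s t \<longleftrightarrow> (\<exists>x\<in>s. \<exists>y\<in>t. g_d G x = g_r G y \<and> z = g_mult G x y)"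
  unfolding gset_mult_def by blast

context groupoid
begin

lemma gset_mult_assoc:
  assumes "s \<subseteq> g_carrier G" "t \<subseteq> g_carrier G" "w \<subseteq> g_carrier G"
  shows "gset_mult G (gset_mult G s t) w = gset_mult G s (gset_mult G t w)"
proof (intro set_eqI iffI)
  fix z assume "z \<in> gset_mult G (gset_mult G s t) w"
  then obtain x y v where z: "x \<in> s" "y \<in> t" "v \<in> w" "g_d G x = g_r G y"
      "g_d G (g_mult G x y) = g_r G v" "z = g_mult G (g_mult G x y) v"
    by (auto simp: gset_mult_iff)
  then have c: "x \<in> g_carrier G" "y \<in> g_carrier G" "v \<in> g_carrier G"
    using assms by auto
  have d: "g_d G y = g_r G v"
    using g_d_mult[OF c(1,2)] z by simp
  then have "g_mult G y v \<in> gset_mult G t w" "g_r G (g_mult G y v) = g_r G y"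
    using z g_r_mult[OF c(2,3)] by (auto simp: gset_mult_iff)
  then show "z \<in> gset_mult G s (gset_mult G t w)"
    using z g_mult_assoc[OF c z(4) d] unfolding gset_mult_iff[of z G s] by metis
next
  fix z assume "z \<in> gset_mult G s (gset_mult G t w)"
  then obtain x y v where z: "x \<in> s" "y \<in> t" "v \<in> w" "g_d G y = g_r G v"
      "g_d G x = g_r G (g_mult G y v)" "z = g_mult G x (g_mult G y v)"
    by (auto simp: gset_mult_iff)
  then have c: "x \<in> g_carrier G" "y \<in> g_carrier G" "v \<in> g_carrier G"
    using assms by auto
  have r: "g_d G x = g_r G y"
    using g_r_mult[OF c(2,3)] z by simp
  then have "g_mult G x y \<in> gset_mult G s t" "g_d G (g_mult G x y) = g_d G y"
    using z g_d_mult[OF c(1,2)] by (auto simp: gset_mult_iff)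
  then show "z \<in> gset_mult G (gset_mult G s t) w"
    using z g_mult_assoc[OF c r z(4)] unfolding gset_mult_iff[of z G _ w] by metis
qed

text \<open>The inverse of x is composable with y exactly when r(x) = r(y), so injectivity of r on s
  leaves only the products of an element's inverse with the element itself.\<close>

lemma gset_mult_star_self:
  assumes s: "s \<in> open_gsets G"
  shows "gset_mult G (gset_star G s) s = g_d G ` s"
proof (intro set_eqI iffI)
  fix z assume "z \<in> gset_mult G (gset_star G s) s"
  then obtain x y where xy: "x \<in> s" "y \<in> s" "g_d G (g_inv G x) = g_r G y" "z = g_mult G (g_inv G x) y"
    by (auto simp: gset_mult_iff gset_star_def)
  then have "x = y"
    using s open_gsets_sub[OF s] d_inv[of x] by (auto simp: open_gsets_def dest: inj_onD)
  then show "z \<in> g_d G ` s" using xy by (auto simp: g_d_def)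
next
  fix z assume "z \<in> g_d G ` s"
  then obtain x where "x \<in> s" "z = g_mult G (g_inv G x) x" by (auto simp: g_d_def)
  then show "z \<in> gset_mult G (gset_star G s) s"
    using open_gsets_sub[OF s] d_inv[of x] by (auto simp: gset_mult_iff gset_star_def)
qed

text \<open>Both r and d fix units, so two units are composable only when equal. On idempotents the
  order of the semigroup thereby becomes inclusion.\<close>

lemma gset_mult_units:
  assumes "e \<subseteq> g_units G" "f \<subseteq> g_units G"
  shows "gset_mult G e f = e \<inter> f"
proof -
  have "g_mult G x x = x" if "x \<in> g_units G" for x
    using r_mult_self[of x] that by (simp add: unit_iff)
  moreover have "g_d G x = x \<and> g_r G x = x" if "x \<in> g_units G" for x
    using that d_unit by (simp add: unit_iff)
  ultimately show ?thesis
    using assms by (fastforce simp: gset_mult_iff subset_iff)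
qed

text \<open>Factor x in e as yz with y and z in e. Equal ranges give y = x, cancellation gives z =
  d(x), and then z and x have the same domain, so x = z is a unit.\<close>

lemma gset_idempotent_units:
  assumes e: "e \<in> open_gsets G" "gset_mult G e e = e"
  shows "e \<subseteq> g_units G"
proof
  fix x assume x: "x \<in> e"
  then obtain y z where yz: "y \<in> e" "z \<in> e" "g_d G y = g_r G z" "x = g_mult G y z"
    using e(2) gset_mult_iff[of x G e e] by blast
  note [simp] = subsetD[OF open_gsets_sub[OF e(1)]]
  have "y = x"
    using e(1) x yz g_r_mult[of y z] by (auto simp: open_gsets_def dest: inj_onD)
  then have "z = g_d G x"
    using left_cancel_unit[of x z] x yz by simp
  then have "g_d G z = g_d G x"
    using d_unit[OF d_in_units[of x]] x by simp
  then have "z = x"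
    using e(1) x yz by (auto simp: open_gsets_def dest: inj_onD)
  then show "x \<in> g_units G"
    using \<open>z = g_d G x\<close> d_in_units[of x] x by simp
qed

text \<open>Composability and injectivity force x = y = w in every product of x, the inverse of y,
  and w, and such a product is r(x)x = x.\<close>

lemma gset_mult_star_mult:
  assumes s: "s \<subseteq> g_carrier G"
    and "inj_on (g_r G) s" "inj_on (g_d G) s"
  shows "gset_mult G (gset_mult G s (gset_star G s)) s = s"
proof (intro set_eqI iffI)
  note [simp] = subsetD[OF s] g_inv_closed r_inv d_inv
  fix z assume "z \<in> gset_mult G (gset_mult G s (gset_star G s)) s"
  then obtain x y w where 1: "x \<in> s" "y \<in> s" "w \<in> s" "g_d G x = g_r G (g_inv G y)"
      "g_d G (g_mult G x (g_inv G y)) = g_r G w" "z = g_mult G (g_mult G x (g_inv G y)) w"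
    by (auto simp: gset_mult_iff gset_star_def)
  then have "x = y" using assms by (auto dest: inj_onD)
  then have "y = w" using 1 g_d_mult[of x "g_inv G y"] assms by (auto dest: inj_onD)
  then show "z \<in> s" using 1 \<open>x = y\<close> r_mult_self[of w] by (simp add: g_r_def)
next
  note [simp] = subsetD[OF s] g_inv_closed r_inv d_inv
  fix z assume z: "z \<in> s"
  have "g_mult G z (g_inv G z) \<in> gset_mult G s (gset_star G s)"
    unfolding gset_mult_iff gset_star_def
    by (rule bexI[of _ z], rule bexI[of _ "g_inv G z"]) (use z in auto)
  moreover have "g_d G (g_mult G z (g_inv G z)) = g_r G z"
    using z g_d_mult[of z "g_inv G z"] by simp
  moreover have "z = g_mult G (g_mult G z (g_inv G z)) z"
    using z r_mult_self[of z] by (simp add: g_r_def)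
  ultimately show "z \<in> gset_mult G (gset_mult G s (gset_star G s)) s"
    using z unfolding gset_mult_iff[of z G _ s] by metis
qed

lemma gset_star_star: "s \<subseteq> g_carrier G \<Longrightarrow> gset_star G (gset_star G s) = s"
  unfolding gset_star_def by (force simp: image_iff subset_iff g_inv_inv)

text \<open>One of the two equations for an inverse yields one inclusion; exchanging s and t yields
  the other, and so uniqueness. If x in s is a product abc, then a shares its range and c its
  domain, so a = c = x, and cancellation identifies b with the inverse of x.\<close>

lemma gset_star_inverse_sub:
  assumes s: "s \<in> open_gsets G" and t: "t \<in> open_gsets G"
    and eq: "gset_mult G (gset_mult G s t) s = s"
  shows "gset_star G s \<subseteq> t"
proof
  fix z assume "z \<in> gset_star G s"
  then obtain x where x: "x \<in> s" "z = g_inv G x" by (auto simp: gset_star_def)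
  then have "x \<in> gset_mult G (gset_mult G s t) s" using eq by simp
  then obtain a b c where abc: "a \<in> s" "b \<in> t" "c \<in> s" "g_d G a = g_r G b"
      "g_d G (g_mult G a b) = g_r G c" "x = g_mult G (g_mult G a b) c"
    by (auto simp: gset_mult_iff)
  have carr: "x \<in> g_carrier G" "a \<in> g_carrier G" "b \<in> g_carrier G" "c \<in> g_carrier G"
    using open_gsets_sub[OF s] open_gsets_sub[OF t] x abc by auto
  have m: "g_mult G a b \<in> g_carrier G"
    by (rule g_mult_closed[OF carr(2,3) abc(4)])
  have "g_r G x = g_r G a" "g_d G x = g_d G c"
    unfolding abc(6) using g_r_mult[OF m carr(4) abc(5)] g_d_mult[OF m carr(4) abc(5)]
      g_r_mult[OF carr(2,3) abc(4)] by simp_all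
  then have ac: "a = x" "c = x"
    using s x(1) abc(1,3) by (auto simp: open_gsets_def dest: inj_onD)
  have "g_mult G x (g_inv G x) = g_mult G x b"
    using g_cancel_right[OF m carr(4) abc(5)] abc(6) unfolding ac by metis
  then have "g_inv G x = b"
    using g_cancel_left[of x b] g_cancel_left[of x "g_inv G x"] carr abc(4) ac
    by (simp add: r_inv g_inv_closed)
  then show "z \<in> t" using x abc(2) by simp
qed

lemma gset_star_range: "s \<subseteq> g_carrier G \<Longrightarrow> g_r G ` gset_star G s = g_d G ` s"
  unfolding gset_star_def by (force simp: image_iff subset_iff r_inv)

lemma gset_star_domain: "s \<subseteq> g_carrier G \<Longrightarrow> g_d G ` gset_star G s = g_r G ` s"
  unfolding gset_star_def by (force simp: image_iff subset_iff d_inv)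

lemma gset_at_star:
  assumes s: "s \<in> open_gsets G" and s': "gset_star G s \<in> open_gsets G" and x: "x \<in> s"
  shows "gset_at G (g_d G x) (gset_star G s) = g_inv G x"
  using gset_at_eq[OF s', of "g_inv G x"] x open_gsets_sub[OF s] r_inv[of x]
  by (auto simp: gset_star_def)

text \<open>Expresses d(st) through t and d(s), the form in which vanishing off d(st) can be
  compared with vanishing of a section transported by t.\<close>

lemma gset_mult_domain:
  assumes "s \<subseteq> g_carrier G" "t \<subseteq> g_carrier G"
  shows "g_d G ` gset_mult G s t = {g_d G y | y. y \<in> t \<and> g_r G y \<in> g_d G ` s}"
proof -
  have d: "g_d G (g_mult G x y) = g_d G y" if "x \<in> s" "y \<in> t" "g_d G x = g_r G y" for x y
    using g_d_mult[of x y] assms that by auto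
  show ?thesis
  proof (intro set_eqI iffI)
    fix v assume "v \<in> g_d G ` gset_mult G s t"
    then obtain x y where "x \<in> s" "y \<in> t" "g_d G x = g_r G y" "v = g_d G (g_mult G x y)"
      by (auto simp: gset_mult_def)
    then show "v \<in> {g_d G y | y. y \<in> t \<and> g_r G y \<in> g_d G ` s}"
      using d by (metis (mono_tags, lifting) imageI mem_Collect_eq)
  next
    fix v assume "v \<in> {g_d G y | y. y \<in> t \<and> g_r G y \<in> g_d G ` s}"
    then obtain x y where xy: "x \<in> s" "y \<in> t" "g_d G x = g_r G y" "v = g_d G y" by force
    then show "v \<in> g_d G ` gset_mult G s t"
      by (intro image_eqI[of _ _ "g_mult G x y"]) (auto simp: d gset_mult_iff)
  qed
qed

lemma full_inverse_semigroup:
  assumes "full_inverse_subsemigroup G S"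
  shows "inverse_semigroup S (gset_mult G)"
proof
  have S: "S \<subseteq> open_gsets G" "\<And>s. s \<in> S \<Longrightarrow> gset_star G s \<in> S"
    using assms by (auto simp: full_inverse_subsemigroup_def)
  note sub = open_gsets_sub[OF subsetD[OF S(1)]]
  fix s assume s: "s \<in> S"
  show "gset_mult G s t \<in> S" if "t \<in> S" for t
    using assms s that by (simp add: full_inverse_subsemigroup_def)
  show "gset_mult G (gset_mult G s t) w = gset_mult G s (gset_mult G t w)" if "t \<in> S" "w \<in> S" for t w
    using s that by (simp add: gset_mult_assoc sub)
  have self: "gset_mult G (gset_mult G s (gset_star G s)) s = s" if "s \<in> S" for s
    using gset_mult_star_mult[OF sub] that S by (auto simp: open_gsets_def)
  show "\<exists>!t. t \<in> S \<and> gset_mult G (gset_mult G s t) s = s \<and> gset_mult G (gset_mult G t s) t = t"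
  proof (rule ex1I[of _ "gset_star G s"])
    show "gset_star G s \<in> S \<and> gset_mult G (gset_mult G s (gset_star G s)) s = s \<and>
        gset_mult G (gset_mult G (gset_star G s) s) (gset_star G s) = gset_star G s"
      using self[OF s] self[OF S(2)[OF s]] S(2)[OF s] by (simp add: gset_star_star[OF sub[OF s]])
    fix t assume t: "t \<in> S \<and> gset_mult G (gset_mult G s t) s = s \<and> gset_mult G (gset_mult G t s) t = t"
    have "gset_star G s \<subseteq> t" "gset_star G t \<subseteq> s"
      using gset_star_inverse_sub[of s t] gset_star_inverse_sub[of t s] s t S by auto
    moreover have "t \<subseteq> gset_star G s"
      using gset_star_star[of t] sub[of t] t \<open>gset_star G t \<subseteq> s\<close>
      by (metis gset_star_def image_mono)
    ultimately show "t = gset_star G s" by blast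
  qed
qed

end

section \<open>Fullness: covers by members of S and upper bounds of idempotents\<close>

lemma full_open_cover:
  assumes "full_inverse_subsemigroup G S" "openin (g_top G) U"
  obtains \<U> where "\<U> \<subseteq> S" "\<Union>\<U> = U"
proof -
  have "(arbitrary union_of (\<lambda>U. U \<in> S)) U"
    using assms by (simp add: full_inverse_subsemigroup_def)
  then have "\<exists>\<U>. \<U> \<subseteq> S \<and> \<Union>\<U> = U"
    by (simp add: union_of_def arbitrary_def)
  then show thesis using that by (elim exE conjE)
qed

lemma full_upper_bound:
  assumes "full_inverse_subsemigroup G S" "e \<in> gset_idempotents G S" "f \<in> gset_idempotents G S"
  obtains h where "h \<in> gset_idempotents G S" "e = gset_mult G e h" "f = gset_mult G f h"
proof -
  have "\<forall>e\<in>gset_idempotents G S. \<forall>f\<in>gset_idempotents G S.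
      \<exists>h\<in>gset_idempotents G S. e = gset_mult G e h \<and> f = gset_mult G f h"
    using assms(1) by (simp add: full_inverse_subsemigroup_def)
  then show thesis using assms(2,3) that by blast
qed

section \<open>Topology of the unit space and of open G-sets\<close>

context r_discrete_groupoid
begin

lemmas r_continuous = local_homeomorphism_continuous[OF g_r_local_homeo]
lemmas d_continuous = local_homeomorphism_continuous[OF g_d_local_homeo]
lemmas r_open = local_homeomorphism_open[OF g_r_local_homeo]

text \<open>Where \<open>r\<close> is injective near a unit, \<open>r (r x) = r x\<close> forces \<open>x\<close> to be a unit as
  soon as \<open>x\<close> and \<open>r x\<close> are both close to it.\<close>

lemma units_open: "openin (g_top G) (g_units G)"
proof (subst openin_subopen, clarify)
  fix u assume u: "u \<in> g_units G"
  then have uc: "u \<in> g_carrier G" "g_r G u = u" by (simp_all add: unit_iff)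
  obtain U where U: "openin (g_top G) U" "u \<in> U"
      "homeomorphic_map (subtopology (g_top G) U) (subtopology (unit_space G) (g_r G ` U)) (g_r G)"
    using g_r_local_homeo uc(1) unfolding local_homeomorphism_def by blast
  have "continuous_map (g_top G) (g_top G) (g_r G)"
    using r_continuous by (simp add: unit_space_def continuous_map_in_subtopology)
  then have "openin (g_top G) (U \<inter> {x \<in> g_carrier G. g_r G x \<in> U})"
    using U(1) openin_continuous_map_preimage by blast
  moreover have "U \<inter> {x \<in> g_carrier G. g_r G x \<in> U} \<subseteq> g_units G"
  proof
    fix x assume x: "x \<in> U \<inter> {x \<in> g_carrier G. g_r G x \<in> U}"
    have "inj_on (g_r G) (topspace (subtopology (g_top G) U))"
      using U(3) homeomorphic_imp_injective_map by blast
    then have "g_r G x = x"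
      using x r_r[of x] r_closed[of x] by (auto dest!: inj_onD[of _ _ "g_r G x" x])
    then show "x \<in> g_units G" using x by (simp add: unit_iff)
  qed
  ultimately show "\<exists>T. openin (g_top G) T \<and> u \<in> T \<and> T \<subseteq> g_units G"
    using U(2) uc by (intro exI[of _ "U \<inter> {x \<in> g_carrier G. g_r G x \<in> U}"]) simp
qed

lemma openin_unit_space: "openin (unit_space G) U \<longleftrightarrow> openin (g_top G) U \<and> U \<subseteq> g_units G"
  using units_open by (simp add: unit_space_def openin_open_subtopology)

lemma range_open: "s \<in> open_gsets G \<Longrightarrow> openin (unit_space G) (g_r G ` s)"
  using r_open by (simp add: open_gsets_def open_map_def)

lemma gset_star_open:
  assumes s: "s \<in> open_gsets G"
  shows "gset_star G s \<in> open_gsets G"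
proof -
  note sub = subsetD[OF open_gsets_sub[OF s]]
  have "gset_star G s = {x \<in> g_carrier G. g_inv G x \<in> s}"
    unfolding gset_star_def using sub g_inv_inv g_inv_closed by (force simp: image_iff)
  then have "openin (g_top G) (gset_star G s)"
    using openin_continuous_map_preimage[OF g_inv_continuous, of s] s by (simp add: open_gsets_def)
  moreover have "inj_on (g_r G) (gset_star G s)" "inj_on (g_d G) (gset_star G s)"
    using s by (auto simp: gset_star_def open_gsets_def inj_on_def r_inv d_inv sub)
  ultimately show ?thesis by (simp add: open_gsets_def)
qed

text \<open>The map u |-> us inverts r on s, so its preimage of V is the image under r of the part
  of s in V, and r is an open map.\<close>

lemma gset_at_continuous:
  assumes s: "s \<in> open_gsets G"
  shows "continuous_map (subtopology (unit_space G) (g_r G ` s)) (g_top G) (\<lambda>u. gset_at G u s)"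
  unfolding continuous_map_def
proof (intro conjI allI impI)
  have sub: "g_r G ` s \<subseteq> topspace (unit_space G)"
    using range_open[OF s] openin_subset by blast
  show "(\<lambda>u. gset_at G u s) \<in> topspace (subtopology (unit_space G) (g_r G ` s)) \<rightarrow> g_carrier G"
    using gset_at_in[OF s] open_gsets_sub[OF s] by auto
  fix V assume V: "openin (g_top G) V"
  have "{u \<in> topspace (subtopology (unit_space G) (g_r G ` s)). gset_at G u s \<in> V} = g_r G ` (s \<inter> V)"
    using sub gset_at_eq[OF s] by auto
  moreover have "openin (unit_space G) (g_r G ` (s \<inter> V))"
    using r_open V s by (simp add: open_gsets_def open_map_def openin_Int)
  ultimately show "openin (subtopology (unit_space G) (g_r G ` s))
      {u \<in> topspace (subtopology (unit_space G) (g_r G ` s)). gset_at G u s \<in> V}"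
    using range_open[OF s] by (auto simp: openin_open_subtopology)
qed

end

section \<open>Transport of sections along G-sets\<close>

text \<open>Total in f, so that pointwise identities involve no options; the restriction to the
  ideal of d(s) is left to \<open>transport_map\<close>.\<close>

definition transport ::
    "'g groupoid_struct \<Rightarrow> ('a, 'g) bundle_struct \<Rightarrow> ('g \<Rightarrow> 'a \<Rightarrow> 'a) \<Rightarrow> 'g set \<Rightarrow> ('g \<Rightarrow> 'a) \<Rightarrow> 'g \<Rightarrow> 'a"
  where "transport G A \<alpha> s f = (\<lambda>u\<in>g_units G. if u \<in> g_r G ` s
    then \<alpha> (gset_at G u s) (f (g_d G (gset_at G u s))) else b_zero A u)"

definition transport_map ::
    "'g groupoid_struct \<Rightarrow> ('a, 'g) bundle_struct \<Rightarrow> ('g \<Rightarrow> 'a \<Rightarrow> 'a) \<Rightarrow> 'g set \<Rightarrow> ('g \<Rightarrow> 'a) \<rightharpoonup> ('g \<Rightarrow> 'a)"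
  where "transport_map G A \<alpha> s =
    (\<lambda>f. if f \<in> Gamma0_on (unit_space G) A (g_d G ` s) then Some (transport G A \<alpha> s f) else None)"

lemma transport_off: "\<lbrakk>u \<in> g_units G; u \<notin> g_r G ` s\<rbrakk> \<Longrightarrow> transport G A \<alpha> s f u = b_zero A u"
  by (simp add: transport_def)

locale groupoid_bundle_action = r_discrete_groupoid G + usc_cstar_bundle "unit_space G" A +
    groupoid_action G A \<alpha>
  for G :: "'g groupoid_struct" and A :: "('a, 'g) bundle_struct" and \<alpha> :: "'g \<Rightarrow> 'a \<Rightarrow> 'a"
begin

abbreviation "X \<equiv> unit_space G"

lemma fibre_r: "x \<in> g_carrier G \<Longrightarrow> cstar_algebra (fibre A (g_r G x))"
  by (rule fibre_cstar) (simp add: units_topspace r_in_units)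

lemma fibre_d: "x \<in> g_carrier G \<Longrightarrow> cstar_algebra (fibre A (g_d G x))"
  by (rule fibre_cstar) (simp add: units_topspace d_in_units)

lemma act_closed:
  "\<lbrakk>x \<in> g_carrier G; a \<in> cs_carrier (fibre A (g_d G x))\<rbrakk> \<Longrightarrow> \<alpha> x a \<in> cs_carrier (fibre A (g_r G x))"
  using act_hom by (simp add: star_hom_def)

lemma act_zero: "x \<in> g_carrier G \<Longrightarrow> \<alpha> x (b_zero A (g_d G x)) = b_zero A (g_r G x)"
  using star_hom_zero[OF fibre_d fibre_r act_hom] by simp

lemma act_inv:
  assumes "x \<in> g_carrier G" "a \<in> cs_carrier (fibre A (g_d G x))"
  shows "\<alpha> (g_inv G x) (\<alpha> x a) = a"
  using act_comp[of "g_inv G x" x a] act_unit[OF d_in_units[of x]] assms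
  by (simp add: g_inv_closed d_inv flip: g_d_def)

text \<open>Joint continuity of the action at \<open>(x, 0)\<close> makes \<open>\<alpha> x\<close> a bounded map.\<close>

lemma act_bounded:
  assumes x: "x \<in> g_carrier G"
  obtains K where "\<And>a. a \<in> cs_carrier (fibre A (g_d G x)) \<Longrightarrow> b_norm A (\<alpha> x a) \<le> K * b_norm A a"
proof -
  interpret D: cstar_algebra "fibre A (g_d G x)" by (rule fibre_d[OF x])
  interpret R: cstar_algebra "fibre A (g_r G x)" by (rule fibre_r[OF x])
  let ?P = "subtopology (prod_topology (g_top G) (b_top A)) {(x, a). b_proj A a = g_d G x}"
  let ?W = "{z \<in> topspace ?P. (\<lambda>(x, a). \<alpha> x a) z \<in> {b \<in> topspace (b_top A). b_norm A b < 1}}"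
  have "openin ?P ?W"
    by (rule openin_continuous_map_preimage[OF act_continuous norm_usc])
  then obtain T where T: "openin (prod_topology (g_top G) (b_top A)) T"
      "?W = T \<inter> {(x, a). b_proj A a = g_d G x}"
    unfolding openin_subtopology by blast
  have "(x, b_zero A (g_d G x)) \<in> ?W"
    using x D.zero_closed R.zero_closed R.norm_zero act_zero[OF x] by (simp add: fibre_carrier_iff)
  then have "(x, b_zero A (g_d G x)) \<in> T" by (subst (asm) T(2)) simp
  then obtain V N where VN: "openin (b_top A) N" "x \<in> V" "b_zero A (g_d G x) \<in> N" "V \<times> N \<subseteq> T"
    using T(1)[unfolded openin_prod_topology_alt, rule_format] by metis
  have "g_d G x \<in> topspace X" using x by (simp add: units_topspace d_in_units)
  then obtain U \<delta> where U: "g_d G x \<in> U" "\<delta> > 0"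
    "\<And>b. \<lbrakk>b \<in> topspace (b_top A); b_proj A b \<in> U; b_norm A b < \<delta>\<rbrakk> \<Longrightarrow> b \<in> N"
    using zero_nbhd[OF _ VN(1,3)] by metis
  have small: "b_norm A (\<alpha> x a) < 1" if a: "a \<in> cs_carrier (fibre A (g_d G x))" "b_norm A a < \<delta>" for a
  proof -
    have "(x, a) \<in> T \<inter> {(x, a). b_proj A a = g_d G x}"
      using U(1,3) VN a by (auto simp: fibre_carrier_iff)
    then show ?thesis by (subst (asm) T(2)[symmetric]) simp
  qed
  have "b_norm A (\<alpha> x a) \<le> (2 / \<delta>) * b_norm A a" if a: "a \<in> cs_carrier (fibre A (g_d G x))" for a
  proof (cases "b_norm A a = 0")
    case True
    then show ?thesis
      using D.norm_eq_zero[OF a] act_zero[OF x] R.norm_zero by simp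
  next
    case False
    then have pos: "b_norm A a > 0" using D.norm_nonneg[OF a] by simp
    \<comment> \<open>The multiple of a by this factor has norm \<delta>/2, so its image has norm
      below 1; dividing by the factor produces the constant 2/\<delta>.\<close>
    define t where "t = \<delta> / (2 * b_norm A a)"
    have t: "t > 0" using pos U(2) by (simp add: t_def)
    have "b_norm A (b_scale A (of_real t) a) = t * b_norm A a"
      using D.norm_scale[OF a, of "of_real t"] t by simp
    also have "\<dots> < \<delta>" using pos U(2) by (simp add: t_def)
    finally have "b_norm A (b_scale A (of_real t) a) < \<delta>" .
    then have "b_norm A (\<alpha> x (b_scale A (of_real t) a)) < 1"
      using small D.scale_closed[OF a, of "of_real t"] by simp
    moreover have "\<alpha> x (b_scale A (of_real t) a) = b_scale A (of_real t) (\<alpha> x a)"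
      using act_hom[OF x] a by (simp add: star_hom_def)
    ultimately have "t * b_norm A (\<alpha> x a) < 1"
      using R.norm_scale[OF act_closed[OF x a], of "of_real t"] t by simp
    then show ?thesis using pos U(2) by (simp add: t_def field_simps)
  qed
  then show thesis by (rule that)
qed

lemma act_contractive:
  assumes x: "x \<in> g_carrier G" and a: "a \<in> cs_carrier (fibre A (g_d G x))"
  shows "b_norm A (\<alpha> x a) \<le> b_norm A a"
proof -
  obtain K where "\<And>a. a \<in> cs_carrier (fibre A (g_d G x)) \<Longrightarrow> b_norm A (\<alpha> x a) \<le> K * b_norm A a"
    using act_bounded[OF x] by blast
  then show ?thesis
    using star_hom_contractive[OF fibre_d[OF x] fibre_r[OF x] act_hom[OF x], of K a] a by simp
qed

section \<open>Transported sections and the isomorphisms they define\<close>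

lemma transport_on:
  assumes "s \<in> open_gsets G" "x \<in> s"
  shows "transport G A \<alpha> s f (g_r G x) = \<alpha> x (f (g_d G x))"
  using assms open_gsets_sub[OF assms(1)] r_in_units[of x] by (auto simp: transport_def gset_at_eq)

lemma transport_closed:
  assumes s: "s \<in> open_gsets G" and f: "f \<in> Gamma0_on X A (g_d G ` s)"
  shows "transport G A \<alpha> s f \<in> Gamma0_on X A (g_r G ` s)"
proof -
  note sub = subsetD[OF open_gsets_sub[OF s]]
  have f\<Gamma>: "f \<in> cs_carrier (Gamma0 X A)" and f0: "\<And>v. \<lbrakk>v \<in> g_units G; v \<notin> g_d G ` s\<rbrakk> \<Longrightarrow> f v = b_zero A v"
    using f by (auto simp: Gamma0_on_def units_topspace)
  have fd: "f (g_d G x) \<in> cs_carrier (fibre A (g_d G x))" if "x \<in> s" for x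
    using Gamma0_fibre[OF f\<Gamma>] sub[OF that] by (simp add: units_topspace d_in_units)
  \<comment> \<open>The unrestricted form of the transported section: continuity and gluing concern
    h, and restricting it to the units gives the extensional section.\<close>
  define h where "h = (\<lambda>u. if u \<in> g_r G ` s
    then \<alpha> (gset_at G u s) (f (g_d G (gset_at G u s))) else b_zero A u)"
  have h_on: "h (g_r G x) = \<alpha> x (f (g_d G x))" if "x \<in> s" for x
    using that by (simp add: h_def gset_at_eq[OF s])
  let ?R = "subtopology X (g_r G ` s)"
  have R: "topspace ?R = g_r G ` s"
    using openin_subset[OF range_open[OF s]] by auto
  have at: "continuous_map ?R (g_top G) (\<lambda>u. gset_at G u s)" by (rule gset_at_continuous[OF s])
  have "restrict h (topspace X) \<in> cs_carrier (Gamma0 X A)"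
  proof (rule Gamma0_glue[OF range_open[OF s]])
    have "continuous_map ?R X (\<lambda>u. g_d G (gset_at G u s))"
      using continuous_map_compose[OF at d_continuous] by (simp add: o_def)
    then have "continuous_map ?R (b_top A) (\<lambda>u. f (g_d G (gset_at G u s)))"
      using continuous_map_compose[OF _ Gamma0_continuous[OF f\<Gamma>]] by (fastforce simp: o_def)
    then have "continuous_map ?R (prod_topology (g_top G) (b_top A))
        (\<lambda>u. (gset_at G u s, f (g_d G (gset_at G u s))))"
      using at by (intro continuous_map_pairedI)
    moreover have "b_proj A (f (g_d G (gset_at G u s))) = g_d G (gset_at G u s)" if "u \<in> g_r G ` s" for u
      using fd gset_at_in(1)[OF s that] by (simp add: fibre_carrier_iff)
    ultimately have "continuous_map ?R
        (subtopology (prod_topology (g_top G) (b_top A)) {(x, a). b_proj A a = g_d G x})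
        (\<lambda>u. (gset_at G u s, f (g_d G (gset_at G u s))))"
      by (simp add: continuous_map_in_subtopology R Pi_iff del: topspace_subtopology)
    from continuous_map_compose[OF this act_continuous]
    show "continuous_map ?R (b_top A) h"
      by (rule continuous_map_eq) (simp add: R h_def del: topspace_subtopology)
    show "h u \<in> cs_carrier (fibre A u)" if "u \<in> topspace X" for u
    proof (cases "u \<in> g_r G ` s")
      case True
      then show ?thesis using h_on act_closed sub fd by auto
    next
      case False
      then show ?thesis
        using cstar_algebra.zero_closed[OF fibre_cstar[OF that]] by (simp add: h_def)
    qed
    show "h u = b_zero A u" if "u \<in> topspace X - g_r G ` s" for u
      using that by (simp add: h_def)
    fix \<epsilon> :: real assume \<epsilon>: "\<epsilon> > 0"
    let ?K = "{v \<in> topspace X. \<epsilon> \<le> b_norm A (f v)}"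
    \<comment> \<open>\<open>?p\<close> is the map d(x) |-> r(x) from d(s) to r(s), written through
      \<open>gset_star G s\<close> so that continuity of \<open>gset_at\<close> applies. The compact
      set required for \<epsilon> is the image of \<open>?K\<close> under it.\<close>
    let ?s = "gset_star G s" and ?p = "\<lambda>v. g_d G (gset_at G v (gset_star G s))"
    have s': "?s \<in> open_gsets G" by (rule gset_star_open[OF s])
    have ran: "g_r G ` ?s = g_d G ` s" by (rule gset_star_range[OF open_gsets_sub[OF s]])
    have Ks: "?K \<subseteq> g_d G ` s"
    proof
      fix v assume v: "v \<in> ?K"
      then have "b_norm A (f v) \<noteq> b_norm A (b_zero A v)"
        using cstar_algebra.norm_zero[OF fibre_cstar[of v]] \<epsilon> by auto
      then show "v \<in> g_d G ` s"
        using f0[of v] v unfolding units_topspace by force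
    qed
    have p: "?p (g_d G x) = g_r G x" if "x \<in> s" for x
      using gset_at_star[OF s s' that] d_inv sub that by simp
    have "continuous_map (subtopology X (g_d G ` s)) X ?p"
      using continuous_map_compose[OF gset_at_continuous[OF s'] d_continuous] ran by (simp add: o_def)
    \<comment> \<open>Continuity of \<open>?p\<close> is known only on d(s), so compactness is first
      moved into that subspace.\<close>
    moreover have "compactin (subtopology X (g_d G ` s)) ?K"
      using Gamma0_compact[OF f\<Gamma> \<epsilon>] Ks by (simp add: compactin_subtopology)
    ultimately have "compactin X (?p ` ?K)" by (rule image_compactin[rotated])
    moreover have "?p ` ?K \<subseteq> g_r G ` s"
    proof
      fix w assume "w \<in> ?p ` ?K"
      then obtain v where "v \<in> ?K" "w = ?p v" by blast
      moreover obtain x where "x \<in> s" "v = g_d G x" using Ks \<open>v \<in> ?K\<close> by blast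
      ultimately show "w \<in> g_r G ` s" using p[of x] by simp
    qed
    moreover have "u \<in> ?p ` ?K" if u: "u \<in> topspace X" and n: "\<epsilon> \<le> b_norm A (h u)" for u
    proof -
      have "u \<in> g_r G ` s"
        using n \<epsilon> cstar_algebra.norm_zero[OF fibre_cstar[OF u]] by (auto simp: h_def split: if_splits)
      then obtain x where x: "x \<in> s" "u = g_r G x" by blast
      \<comment> \<open>Contractivity enters here: a value of the transported section of norm at
        least \<epsilon> comes from a value of f of norm at least \<epsilon>.\<close>
      have "\<epsilon> \<le> b_norm A (f (g_d G x))"
        using n h_on[OF x(1)] x(2) act_contractive[OF sub[OF x(1)] fd[OF x(1)]] by simp
      then have "g_d G x \<in> ?K" using sub[OF x(1)] by (simp add: units_topspace d_in_units)
      moreover have "u = ?p (g_d G x)" using p[OF x(1)] x(2) by simp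
      ultimately show ?thesis by (rule image_eqI[rotated])
    qed
    ultimately show "\<exists>K. compactin X K \<and> K \<subseteq> g_r G ` s \<and>
        (\<forall>u\<in>topspace X. \<epsilon> \<le> b_norm A (h u) \<longrightarrow> u \<in> K)"
      by (intro exI[of _ "?p ` ?K"] conjI ballI impI)
  qed
  moreover have "restrict h (topspace X) = transport G A \<alpha> s f"
    by (simp add: h_def transport_def units_topspace)
  ultimately show ?thesis
    by (simp add: Gamma0_on_def units_topspace transport_off)
qed

text \<open>At d(x) the two transports apply \<open>\<alpha> x\<close> and then the action of the
  inverse of x; off d(s) both sides vanish because f lies in the ideal of d(s).\<close>

lemma transport_inverse:
  assumes s: "s \<in> open_gsets G" and f: "f \<in> Gamma0_on X A (g_d G ` s)"
  shows "transport G A \<alpha> (gset_star G s) (transport G A \<alpha> s f) = f"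
proof (rule Gamma0_eqI)
  note s' = gset_star_open[OF s]
  note sub = subsetD[OF open_gsets_sub[OF s]]
  have "transport G A \<alpha> s f \<in> Gamma0_on X A (g_d G ` gset_star G s)"
    using transport_closed[OF s f] by (simp add: gset_star_domain[OF open_gsets_sub[OF s]])
  then show "transport G A \<alpha> (gset_star G s) (transport G A \<alpha> s f) \<in> cs_carrier (Gamma0 X A)"
    using transport_closed[OF s'] by (auto simp: Gamma0_on_def)
  show "f \<in> cs_carrier (Gamma0 X A)" using f by (simp add: Gamma0_on_def)
  fix u assume u: "u \<in> topspace X"
  show "transport G A \<alpha> (gset_star G s) (transport G A \<alpha> s f) u = f u"
  proof (cases "u \<in> g_d G ` s")
    case True
    then obtain x where x: "x \<in> s" "u = g_d G x" by blast
    have "f u \<in> cs_carrier (fibre A (g_d G x))"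
      using Gamma0_fibre[OF \<open>f \<in> cs_carrier (Gamma0 X A)\<close> u] x by simp
    then show ?thesis
      using transport_on[OF s' imageI[OF x(1), of "g_inv G", folded gset_star_def], of "transport G A \<alpha> s f"]
        transport_on[OF s x(1), of f] act_inv[OF sub[OF x(1)]] x sub[OF x(1)]
      by (simp add: r_inv d_inv)
  next
    case False
    then show ?thesis
      using u f by (simp add: transport_off gset_star_range[OF open_gsets_sub[OF s]] Gamma0_on_def units_topspace)
  qed
qed

lemma transport_star_iso:
  assumes s: "s \<in> open_gsets G"
  shows "star_iso (Gamma0 X A\<lparr>cs_carrier := Gamma0_on X A (g_d G ` s)\<rparr>)
    (Gamma0 X A\<lparr>cs_carrier := Gamma0_on X A (g_r G ` s)\<rparr>) (transport G A \<alpha> s)"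
proof -
  let ?\<Gamma> = "Gamma0 X A" and ?D = "Gamma0_on X A (g_d G ` s)" and ?\<beta> = "transport G A \<alpha> s"
  note sub = subsetD[OF open_gsets_sub[OF s]]
  have D: "f \<in> cs_carrier ?\<Gamma>" if "f \<in> ?D" for f using that by (simp add: Gamma0_on_def)
  have T: "?\<beta> f \<in> cs_carrier ?\<Gamma>" if "f \<in> ?D" for f
    using transport_closed[OF s that] by (simp add: Gamma0_on_def)
  have ideal: "closed_ideal ?\<Gamma> ?D" by (rule Gamma0_on_closed_ideal)
  \<comment> \<open>Each identity is tested at the points r(x) with x in s, where
    \<open>\<alpha> x\<close> is a homomorphism, and off r(s), where every term is zero.\<close>
  have eq: "f = g" if "f \<in> cs_carrier ?\<Gamma>" "g \<in> cs_carrier ?\<Gamma>"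
      "\<And>x. x \<in> s \<Longrightarrow> f (g_r G x) = g (g_r G x)"
      "\<And>u. \<lbrakk>u \<in> topspace X; u \<notin> g_r G ` s\<rbrakk> \<Longrightarrow> f u = g u" for f g
    using that by (intro Gamma0_eqI) blast+
  have on: "?\<beta> f (g_r G x) = \<alpha> x (f (g_d G x))" if "x \<in> s" for f x
    by (rule transport_on[OF s that])
  have off: "?\<beta> f u = cs_zero (fibre A u)" if "u \<in> topspace X" "u \<notin> g_r G ` s" for f u
    using that by (simp add: transport_off units_topspace)
  have dX: "g_d G x \<in> topspace X" and rX: "g_r G x \<in> topspace X" if "x \<in> s" for x
    using sub[OF that] by (simp_all add: units_topspace d_in_units r_in_units)
  have fd: "f (g_d G x) \<in> cs_carrier (fibre A (g_d G x))" if "x \<in> s" "f \<in> ?D" for f x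
    using Gamma0_fibre[OF D[OF that(2)] dX[OF that(1)]] .
  note hom = act_hom[OF sub, unfolded star_hom_def]
  note zs = cstar_algebra.add_zero[OF fibre_cstar] cstar_algebra.scale_zero_right[OF fibre_cstar]
    cstar_algebra.mult_zero_left[OF fibre_cstar] cstar_algebra.star_zero[OF fibre_cstar]
    cstar_algebra.zero_closed[OF fibre_cstar]
  have "?\<beta> (cs_add ?\<Gamma> f g) = cs_add ?\<Gamma> (?\<beta> f) (?\<beta> g)" if "f \<in> ?D" "g \<in> ?D" for f g
  proof (rule eq)
    show "?\<beta> (cs_add ?\<Gamma> f g) \<in> cs_carrier ?\<Gamma>"
      using ideal that by (intro T) (simp add: closed_ideal_def cs_subspace_def)
  qed (use that hom in \<open>auto simp: Gamma0_closed T on off Gamma0_apply dX rX fd zs simp del: fibre_sel\<close>)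
  moreover have "?\<beta> (cs_mult ?\<Gamma> f g) = cs_mult ?\<Gamma> (?\<beta> f) (?\<beta> g)" if "f \<in> ?D" "g \<in> ?D" for f g
  proof (rule eq)
    show "?\<beta> (cs_mult ?\<Gamma> f g) \<in> cs_carrier ?\<Gamma>"
      using ideal that D by (intro T) (simp add: closed_ideal_def)
  qed (use that hom in \<open>auto simp: Gamma0_closed T on off Gamma0_apply dX rX fd zs simp del: fibre_sel\<close>)
  moreover have "?\<beta> (cs_scale ?\<Gamma> c f) = cs_scale ?\<Gamma> c (?\<beta> f)" if "f \<in> ?D" for f c
  proof (rule eq)
    show "?\<beta> (cs_scale ?\<Gamma> c f) \<in> cs_carrier ?\<Gamma>"
      using ideal that by (intro T) (simp add: closed_ideal_def cs_subspace_def)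
  qed (use that hom in \<open>auto simp: Gamma0_closed T on off Gamma0_apply dX rX fd zs simp del: fibre_sel\<close>)
  moreover have "?\<beta> (cs_star ?\<Gamma> f) = cs_star ?\<Gamma> (?\<beta> f)" if "f \<in> ?D" for f
  proof (rule eq)
    show "?\<beta> (cs_star ?\<Gamma> f) \<in> cs_carrier ?\<Gamma>"
      using Gamma0_on_star[OF that] by (rule T)
  qed (use that hom in \<open>auto simp: Gamma0_closed T on off Gamma0_apply dX rX fd zs simp del: fibre_sel\<close>)
  moreover have "bij_betw ?\<beta> ?D (Gamma0_on X A (g_r G ` s))"
  proof (rule bij_betwI[where g = "transport G A \<alpha> (gset_star G s)"])
    note s' = gset_star_open[OF s]
    note ds = gset_star_domain[OF open_gsets_sub[OF s]] gset_star_range[OF open_gsets_sub[OF s]]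
      gset_star_star[OF open_gsets_sub[OF s]]
    show "?\<beta> \<in> ?D \<rightarrow> Gamma0_on X A (g_r G ` s)" using transport_closed[OF s] by auto
    show "transport G A \<alpha> (gset_star G s) \<in> Gamma0_on X A (g_r G ` s) \<rightarrow> ?D"
      using transport_closed[OF s'] by (auto simp: ds)
    show "transport G A \<alpha> (gset_star G s) (?\<beta> f) = f" if "f \<in> ?D" for f
      using transport_inverse[OF s that] .
    show "?\<beta> (transport G A \<alpha> (gset_star G s) g) = g" if "g \<in> Gamma0_on X A (g_r G ` s)" for g
      using transport_inverse[OF s', of g] that by (simp add: ds)
  qed
  ultimately show ?thesis
    using transport_closed[OF s] by (simp add: star_iso_def star_hom_def)
qed

text \<open>The right-hand side is the domain of the composite under \<open>map_comp\<close>, so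
  this is the equality of domains that multiplicativity requires.\<close>

lemma transport_comp_domain:
  assumes s: "s \<in> open_gsets G" and t: "t \<in> open_gsets G"
  shows "f \<in> Gamma0_on X A (g_d G ` gset_mult G s t) \<longleftrightarrow>
    f \<in> Gamma0_on X A (g_d G ` t) \<and> transport G A \<alpha> t f \<in> Gamma0_on X A (g_d G ` s)"
    (is "?lhs \<longleftrightarrow> ?rhs")
proof
  note sub = subsetD[OF open_gsets_sub[OF t]]
  note dom = gset_mult_domain[OF open_gsets_sub[OF s] open_gsets_sub[OF t]]
  {
    assume ?lhs
    then have f: "f \<in> Gamma0_on X A (g_d G ` t)"
      unfolding Gamma0_on_def dom by blast
    have "transport G A \<alpha> t f u = b_zero A u" if u: "u \<in> g_units G - g_d G ` s" for u
    proof (cases "u \<in> g_r G ` t")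
      case True
      then obtain y where y: "y \<in> t" "u = g_r G y" by blast
      \<comment> \<open>An element of t with the domain of y and with range in d(s) would be y
        itself, since d is injective on t; but r(y) = u lies outside d(s).\<close>
      have "g_d G y \<notin> g_d G ` gset_mult G s t"
      proof
        assume "g_d G y \<in> g_d G ` gset_mult G s t"
        then obtain y' where "y' \<in> t" "g_r G y' \<in> g_d G ` s" "g_d G y = g_d G y'"
          unfolding dom by blast
        moreover have "y = y'" using calculation y t by (auto simp: open_gsets_def dest: inj_onD)
        ultimately show False using u y by blast
      qed
      then have "f (g_d G y) = b_zero A (g_d G y)"
        using \<open>?lhs\<close> d_in_units[OF sub[OF y(1)]] by (simp add: Gamma0_on_def units_topspace)
      then show ?thesis
        using transport_on[OF t y(1), of f] act_zero[OF sub[OF y(1)]] y by simp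
    next
      case False
      then show ?thesis using u by (simp add: transport_off)
    qed
    then show ?rhs
      using f transport_closed[OF t f] by (simp add: Gamma0_on_def units_topspace)
  }
  assume r: ?rhs
  have "f u = b_zero A u" if u: "u \<in> g_units G" "u \<notin> g_d G ` gset_mult G s t" for u
  proof (cases "u \<in> g_d G ` t")
    case True
    then obtain y where y: "y \<in> t" "u = g_d G y" by blast
    then have yc: "y \<in> g_carrier G" using sub by blast
    have "g_r G y \<notin> g_d G ` s" using u y unfolding dom by blast
    then have "\<alpha> y (f u) = b_zero A (g_r G y)"
      using r transport_on[OF t y(1), of f] y r_in_units[OF yc] by (simp add: Gamma0_on_def units_topspace)
    moreover have "f u \<in> cs_carrier (fibre A (g_d G y))"
      using r Gamma0_fibre[of f u] u y by (simp add: Gamma0_on_def units_topspace)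
    \<comment> \<open>Injectivity of \<open>\<alpha> y\<close> in explicit form: a vector sent to
      zero is recovered by letting the inverse of y act on zero.\<close>
    ultimately have "f u = \<alpha> (g_inv G y) (b_zero A (g_r G y))"
      using act_inv[OF yc] by metis
    then show ?thesis
      using act_zero[OF g_inv_closed[OF yc]] yc y by (simp add: d_inv r_inv)
  next
    case False
    then show ?thesis using r u by (simp add: Gamma0_on_def units_topspace)
  qed
  then show ?lhs using r by (simp add: Gamma0_on_def units_topspace)
qed

lemma transport_comp:
  assumes s: "s \<in> open_gsets G" and t: "t \<in> open_gsets G" and st: "gset_mult G s t \<in> open_gsets G"
    and f: "f \<in> Gamma0_on X A (g_d G ` gset_mult G s t)"
  shows "transport G A \<alpha> s (transport G A \<alpha> t f) = transport G A \<alpha> (gset_mult G s t) f"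
proof (rule Gamma0_eqI)
  note subs = subsetD[OF open_gsets_sub[OF s]] and subt = subsetD[OF open_gsets_sub[OF t]]
  have f2: "f \<in> Gamma0_on X A (g_d G ` t)" "transport G A \<alpha> t f \<in> Gamma0_on X A (g_d G ` s)"
    using f transport_comp_domain[OF s t] by blast+
  show "transport G A \<alpha> s (transport G A \<alpha> t f) \<in> cs_carrier (Gamma0 X A)"
    using transport_closed[OF s f2(2)] by (simp add: Gamma0_on_def)
  show "transport G A \<alpha> (gset_mult G s t) f \<in> cs_carrier (Gamma0 X A)"
    using transport_closed[OF st f] by (simp add: Gamma0_on_def)
  fix u assume "u \<in> topspace X"
  then have u: "u \<in> g_units G" by (simp add: units_topspace)
  show "transport G A \<alpha> s (transport G A \<alpha> t f) u = transport G A \<alpha> (gset_mult G s t) f u"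
  proof (cases "u \<in> g_r G ` gset_mult G s t")
    case True
    then obtain x y where xy: "x \<in> s" "y \<in> t" "g_d G x = g_r G y" "u = g_r G (g_mult G x y)"
      by (auto simp: gset_mult_def)
    then have m: "g_mult G x y \<in> gset_mult G s t" by (auto simp: gset_mult_iff)
    have c: "x \<in> g_carrier G" "y \<in> g_carrier G" using xy subs subt by auto
    have u: "u = g_r G x" using g_r_mult[OF c xy(3)] xy(4) by simp
    have "f (g_d G y) \<in> cs_carrier (fibre A (g_d G y))"
      using f Gamma0_fibre[of f] d_in_units[OF c(2)] by (simp add: Gamma0_on_def units_topspace)
    then have "\<alpha> x (\<alpha> y (f (g_d G y))) = \<alpha> (g_mult G x y) (f (g_d G y))"
      by (rule act_comp[OF c xy(3)])
    then show ?thesis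
      using transport_on[OF st m, of f] transport_on[OF s xy(1), of "transport G A \<alpha> t f"]
        transport_on[OF t xy(2), of f] g_d_mult[OF c xy(3)] xy(3,4) u by simp
  next
    case False
    \<comment> \<open>Off r(st) zero arises in two ways: u is outside r(s), or u = r(x) with d(x)
      outside r(t), and then the inner section vanishes at d(x).\<close>
    have "transport G A \<alpha> s (transport G A \<alpha> t f) u = b_zero A u"
    proof (cases "u \<in> g_r G ` s")
      case True
      then obtain x where x: "x \<in> s" "u = g_r G x" by blast
      have xc: "x \<in> g_carrier G" using x subs by blast
      have "g_d G x \<notin> g_r G ` t"
      proof
        assume "g_d G x \<in> g_r G ` t"
        then obtain y where y: "y \<in> t" "g_d G x = g_r G y" by blast
        then have "g_mult G x y \<in> gset_mult G s t" using x by (auto simp: gset_mult_iff)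
        then show False using False g_r_mult[OF xc subt[OF y(1)] y(2)] x by (metis imageI)
      qed
      then show ?thesis
        using transport_on[OF s x(1), of "transport G A \<alpha> t f"] act_zero[OF xc] x
        by (simp add: transport_off d_in_units xc)
    qed (simp add: transport_off u)
    then show ?thesis using False u by (simp add: transport_off)
  qed
qed

lemma transport_map_comp:
  assumes "s \<in> open_gsets G" "t \<in> open_gsets G" "gset_mult G s t \<in> open_gsets G"
  shows "transport_map G A \<alpha> (gset_mult G s t) = transport_map G A \<alpha> s \<circ>\<^sub>m transport_map G A \<alpha> t"
proof
  fix f
  show "transport_map G A \<alpha> (gset_mult G s t) f = (transport_map G A \<alpha> s \<circ>\<^sub>m transport_map G A \<alpha> t) f"
    using transport_comp[OF assms, of f] transport_comp_domain[OF assms(1,2), of f]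
    by (simp add: transport_map_def map_comp_def)
qed

lemma transport_map_partial_iso:
  assumes s: "s \<in> open_gsets G"
  shows "partial_iso (Gamma0 X A) (Gamma0_on X A (g_d G ` s)) (Gamma0_on X A (g_r G ` s))
    (transport_map G A \<alpha> s)"
proof -
  let ?D = "Gamma0_on X A (g_d G ` s)" and ?R = "Gamma0_on X A (g_r G ` s)"
  have iso: "star_iso (Gamma0 X A\<lparr>cs_carrier := ?D\<rparr>) (Gamma0 X A\<lparr>cs_carrier := ?R\<rparr>) (transport G A \<alpha> s)"
    by (rule transport_star_iso[OF s])
  then have "transport G A \<alpha> s ` ?D = ?R"
    by (simp add: star_iso_def bij_betw_def)
  moreover have "ran (transport_map G A \<alpha> s) = transport G A \<alpha> s ` ?D"
    by (force simp: ran_def transport_map_def image_iff)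
  ultimately have "ran (transport_map G A \<alpha> s) = ?R" by simp
  moreover have "dom (transport_map G A \<alpha> s) = ?D"
    by (auto simp: transport_map_def dom_def)
  moreover have "star_iso (Gamma0 X A\<lparr>cs_carrier := ?D\<rparr>) (Gamma0 X A\<lparr>cs_carrier := ?R\<rparr>)
      (\<lambda>f. the (transport_map G A \<alpha> s f))"
  proof (rule star_iso_cong[OF iso])
    show "the (transport_map G A \<alpha> s f) = transport G A \<alpha> s f"
      if "f \<in> cs_carrier (Gamma0 X A\<lparr>cs_carrier := ?D\<rparr>)" for f
      using that by (simp add: transport_map_def)
  qed (use Gamma0_on_closed_ideal[of "g_d G ` s"] Gamma0_on_star[of _ "g_d G ` s"]
      in \<open>auto simp: closed_ideal_def cs_subspace_def\<close>)
  ultimately show ?thesis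
    by (simp add: partial_iso_def)
qed

section \<open>Density of the sections supported on idempotents\<close>

lemma full_covers_compact:
  assumes S: "full_inverse_subsemigroup G S" and K: "compactin X K" "K \<noteq> {}"
  obtains e where "e \<in> S" "e \<subseteq> g_units G" "K \<subseteq> e"
proof -
  have SG: "S \<subseteq> open_gsets G" using S by (simp add: full_inverse_subsemigroup_def)
  let ?E = "gset_idempotents G S"
  have idem: "e \<in> ?E" if "e \<in> S" "e \<subseteq> g_units G" for e
    using that gset_mult_units[of e e] by (simp add: gset_idempotents_def)
  have units: "e \<subseteq> g_units G" if "e \<in> ?E" for e
    using gset_idempotent_units[OF subsetD[OF SG]] that by (simp add: gset_idempotents_def)
  \<comment> \<open>The unit space is open in G, so it is a union of members of S; these consist of
    units and are therefore idempotent.\<close>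
  obtain \<U> where \<U>: "\<U> \<subseteq> S" "\<Union>\<U> = g_units G"
    using full_open_cover[OF S units_open] .
  have Uunits: "e \<subseteq> g_units G" if "e \<in> \<U>" for e
    using Union_upper[OF that] \<U>(2) by simp
  have Uopen: "openin X e" if "e \<in> \<U>" for e
    using subsetD[OF SG subsetD[OF \<U>(1) that]] Uunits[OF that]
    unfolding openin_unit_space open_gsets_def by simp
  have KU: "K \<subseteq> \<Union>\<U>"
    using compactin_subset_topspace[OF K(1)] \<U>(2) by (simp add: units_topspace)
  have "\<exists>\<F>. finite \<F> \<and> \<F> \<subseteq> \<U> \<and> K \<subseteq> \<Union>\<F>"
    by (rule compactinD[OF K(1) _ KU]) (rule Uopen)
  then obtain \<F> where \<F>: "finite \<F>" "\<F> \<subseteq> \<U>" "K \<subseteq> \<Union>\<F>"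
    by (elim exE conjE)
  \<comment> \<open>Among sets of units e = eh means inclusion, so a common upper bound contains the
    union; induction extends this to finite subcovers.\<close>
  have ub: "\<exists>h\<in>?E. e \<union> f \<subseteq> h" if ef: "e \<in> ?E" "f \<in> ?E" for e f
  proof -
    obtain h where h: "h \<in> ?E" "e = gset_mult G e h" "f = gset_mult G f h"
      using full_upper_bound[OF S ef] .
    have "e = e \<inter> h" "f = f \<inter> h"
      using h(2,3) gset_mult_units[OF units[OF ef(1)] units[OF h(1)]]
        gset_mult_units[OF units[OF ef(2)] units[OF h(1)]] by simp_all
    then show ?thesis using h(1) by blast
  qed
  \<comment> \<open>The induction needs a first idempotent, and S itself is allowed to be empty when
    G is.\<close>
  have "\<F> \<noteq> {}" using K(2) \<F>(3) by auto
  with \<F>(1) have "\<F> \<subseteq> ?E \<Longrightarrow> \<exists>e\<in>?E. \<Union>\<F> \<subseteq> e"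
  proof (induction rule: finite_ne_induct)
    case (insert e \<F>)
    then obtain f where f: "f \<in> ?E" "\<Union>\<F> \<subseteq> f" by auto
    obtain h where h: "h \<in> ?E" "e \<union> f \<subseteq> h"
      using ub[of e f] insert.prems f(1) by auto
    have "\<Union>(insert e \<F>) \<subseteq> h" using f(2) h(2) by auto
    with h(1) show ?case by (rule bexI[rotated])
  qed auto
  moreover have "\<F> \<subseteq> ?E"
  proof
    fix e assume "e \<in> \<F>"
    then have "e \<in> \<U>" by (rule subsetD[OF \<F>(2)])
    then show "e \<in> ?E" using subsetD[OF \<U>(1)] Uunits by (intro idem)
  qed
  ultimately obtain e where e: "e \<in> ?E" "\<Union>\<F> \<subseteq> e" by (elim meta_impE bexE)
  show thesis
  proof (rule that)
    show "e \<in> S" using e(1) by (simp add: gset_idempotents_def)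
    show "e \<subseteq> g_units G" by (rule units[OF e(1)])
    show "K \<subseteq> e" using \<F>(3) e(2) by (rule order_trans)
  qed
qed

lemma Gamma0_on_dense:
  assumes S: "full_inverse_subsemigroup G S" and f: "f \<in> cs_carrier (Gamma0 X A)" and \<epsilon>: "\<epsilon> > 0"
  obtains g where "g = cs_zero (Gamma0 X A) \<or> (\<exists>s\<in>S. g \<in> Gamma0_on X A (g_d G ` s))"
    "g \<in> cs_carrier (Gamma0 X A)" "cs_dist (Gamma0 X A) f g \<le> \<epsilon>"
proof -
  let ?K = "{u \<in> topspace X. \<epsilon> \<le> b_norm A (f u)}"
  have K: "compactin X ?K" by (rule Gamma0_compact[OF f \<epsilon>])
  \<comment> \<open>If \<open>?K\<close> is empty, no idempotent is produced; the empty set takes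
    its place and the cut-off section is then zero, which accounts for the first alternative of the
    conclusion.\<close>
  obtain e where e: "?K = {} \<and> e = {} \<or> e \<in> S \<and> e \<subseteq> g_units G" "openin X e" "?K \<subseteq> e"
  proof (cases "?K = {}")
    case False
    obtain e where "e \<in> S" "e \<subseteq> g_units G" "?K \<subseteq> e"
      using full_covers_compact[OF S K False] .
    moreover have "openin X e"
      using S calculation by (auto simp: openin_unit_space full_inverse_subsemigroup_def open_gsets_def)
    ultimately show thesis using that by blast
  qed (use that[of "{}"] in auto)
  have "completely_regular_space X"
    using base_locally_compact base_Hausdorff locally_compact_regular_imp_completely_regular_space by blast
  then obtain \<psi> :: "'g \<Rightarrow> real" where \<psi>: "continuous_map X (top_of_set {0..1}) \<psi>"
      "\<psi> ` ?K \<subseteq> {0}" "\<psi> ` (topspace X - e) \<subseteq> {1}"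
    using Urysohn_completely_regular_closed_compact[of 0 1 X "topspace X - e" ?K] K e(2,3)
    by (auto simp: disjnt_iff)
  \<comment> \<open>The Urysohn function is 0 on \<open>?K\<close> and 1 off e; the cut-off has to
    be the reverse.\<close>
  define \<phi> where "\<phi> = (\<lambda>u. 1 - \<psi> u)"
  have \<psi>c: "continuous_map X euclidean \<psi>" and \<psi>01: "\<And>u. u \<in> topspace X \<Longrightarrow> \<psi> u \<in> {0..1}"
    using \<psi>(1) by (auto simp: continuous_map_in_subtopology)
  have \<phi>1: "\<phi> u = 1" if "u \<in> ?K" for u using \<psi>(2) that by (auto simp: \<phi>_def)
  have \<phi>0: "\<phi> u = 0" if "u \<in> topspace X - e" for u using \<psi>(3) that by (auto simp: \<phi>_def)
  define g where "g = (\<lambda>u\<in>topspace X. b_scale A (of_real (\<phi> u)) (f u))"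
  have \<phi>01: "0 \<le> \<phi> u" "\<phi> u \<le> 1" if "u \<in> topspace X" for u
    using \<psi>01[OF that] by (auto simp: \<phi>_def)
  have "continuous_map X euclidean (\<lambda>u. complex_of_real (\<phi> u))"
    using continuous_map_compose[OF \<psi>c, of euclidean "\<lambda>x. complex_of_real (1 - x)"]
    by (simp add: o_def \<phi>_def continuous_map_iff_continuous2 continuous_intros)
  then have g: "g \<in> cs_carrier (Gamma0 X A)"
    unfolding g_def using \<phi>01 by (intro Gamma0_scale_fun[OF f, where M = 1]) auto
  moreover have "cs_dist (Gamma0 X A) f g \<le> \<epsilon>"
  proof (rule Gamma0_dist_least[OF f g])
    fix u assume u: "u \<in> topspace X"
    interpret F: cstar_algebra "fibre A u" by (rule fibre_cstar[OF u])
    have fu: "f u \<in> cs_carrier (fibre A u)" by (rule Gamma0_fibre[OF f u])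
    have "b_add A (b_scale A 1 (f u)) (b_scale A (of_real (- \<phi> u)) (f u)) = b_scale A (1 + of_real (- \<phi> u)) (f u)"
      using F.scale_add_left[OF fu, of 1 "of_real (- \<phi> u)"] by simp
    then have "cs_dist (fibre A u) (f u) (g u) = cmod (of_real (1 - \<phi> u)) * b_norm A (f u)"
      using u F.cs_dist_eq[OF fu Gamma0_fibre[OF g u]] F.scale_one[OF fu] F.norm_scale[OF fu]
        F.scale_scale[OF fu] by (simp add: g_def)
    also have "\<dots> = (1 - \<phi> u) * b_norm A (f u)"
      using \<phi>01[OF u] by (simp only: norm_of_real)
    \<comment> \<open>On \<open>?K\<close> the factor is 0; elsewhere it is at most 1 and f has norm
      below \<epsilon>.\<close>
    also have "\<dots> \<le> \<epsilon>"
    proof (cases "u \<in> ?K")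
      case True
      then show ?thesis using \<phi>1 \<epsilon> by simp
    next
      case False
      then have "b_norm A (f u) \<le> \<epsilon>" using u by auto
      then have "(1 - \<phi> u) * b_norm A (f u) \<le> 1 * \<epsilon>"
        using \<phi>01[OF u] F.norm_nonneg[OF fu] by (intro mult_mono) auto
      then show ?thesis by simp
    qed
    finally show "cs_dist (fibre A u) (f u) (g u) \<le> \<epsilon>" .
  qed (use \<epsilon> in simp)
  moreover have "g u = b_zero A u" if "u \<in> topspace X - e" for u
    using that \<phi>0 cstar_algebra.scale_zero[OF fibre_cstar Gamma0_fibre[OF f], of u] by (auto simp: g_def)
  then have on: "g \<in> Gamma0_on X A e" using g by (simp add: Gamma0_on_def)
  have "g = cs_zero (Gamma0 X A) \<or> (\<exists>s\<in>S. g \<in> Gamma0_on X A (g_d G ` s))"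
    using e(1)
  proof
    assume "?K = {} \<and> e = {}"
    then have "g = cs_zero (Gamma0 X A)"
      using on by (intro Gamma0_eqI g Gamma0_zero_closed) (simp add: Gamma0_on_def Gamma0_sel)
    then show ?thesis ..
  next
    assume e': "e \<in> S \<and> e \<subseteq> g_units G"
    then have "g \<in> Gamma0_on X A (g_d G ` e)" using on units_domain[of e] by simp
    then show ?thesis using e' by blast
  qed
  ultimately show thesis using that by blast
qed

end

section \<open>Existence and uniqueness of the inverse semigroup action\<close>

theorem theorem5p3:
  fixes G :: "'g groupoid_struct" and A :: "('a, 'g) bundle_struct"
    and \<alpha> :: "'g \<Rightarrow> 'a \<Rightarrow> 'a" and S :: "'g set set"
  assumes "r_discrete_groupoid G"
    and "usc_cstar_bundle (unit_space G) A"
    and "groupoid_action G A \<alpha>"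
    and "full_inverse_subsemigroup G S"
  shows "\<exists>!\<beta>.
    inverse_semigroup_action S (gset_mult G) (Gamma0 (unit_space G) A) \<beta> \<and>
    (\<forall>s\<in>S.
      partial_iso (Gamma0 (unit_space G) A)
        (Gamma0_on (unit_space G) A (g_d G ` s)) (Gamma0_on (unit_space G) A (g_r G ` s)) (\<beta> s) \<and>
      (\<forall>f\<in>Gamma0_on (unit_space G) A (g_d G ` s). \<forall>u\<in>g_units G.
        the (\<beta> s f) u =
          (if u \<in> g_r G ` s
           then \<alpha> (gset_at G u s) (f (g_d G (gset_at G u s)))
           else b_zero A u)))"
proof -
  interpret groupoid_bundle_action G A \<alpha>
    using assms by (simp add: groupoid_bundle_action_def)
  let ?\<Gamma> = "Gamma0 X A"
  interpret \<Gamma>: cstar_algebra ?\<Gamma> by (rule Gamma0_cstar_algebra)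
  interpret M: Metric_space "cs_carrier ?\<Gamma>" "cs_dist ?\<Gamma>" by (rule \<Gamma>.cs_metric)
  interpret S: inverse_semigroup S "gset_mult G" by (rule full_inverse_semigroup[OF assms(4)])
  have SG: "s \<in> open_gsets G" if "s \<in> S" for s
    using assms(4) that by (auto simp: full_inverse_subsemigroup_def)
  \<comment> \<open>Restriction to S makes \<beta> extensional, so that uniqueness can be an
    equality of functions.\<close>
  define \<beta> where "\<beta> = restrict (transport_map G A \<alpha>) S"
  have iso: "partial_iso ?\<Gamma> (Gamma0_on X A (g_d G ` s)) (Gamma0_on X A (g_r G ` s)) (\<beta> s)" if "s \<in> S" for s
    using transport_map_partial_iso[OF SG[OF that]] that by (simp add: \<beta>_def)
  then have dom: "dom (\<beta> s) = Gamma0_on X A (g_d G ` s)" if "s \<in> S" for s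
    using that by (simp add: partial_iso_def)
  show ?thesis
  proof (rule ex1I[of _ \<beta>], intro conjI ballI)
    show "inverse_semigroup_action S (gset_mult G) ?\<Gamma> \<beta>"
    proof
      show "\<beta> \<in> S \<rightarrow>\<^sub>E paut ?\<Gamma>"
        using iso Gamma0_on_closed_ideal by (auto simp: \<beta>_def paut_def)
      show "\<beta> (gset_mult G s t) = \<beta> s \<circ>\<^sub>m \<beta> t" if "s \<in> S" "t \<in> S" for s t
        using that transport_map_comp SG S.sg_closed by (simp add: \<beta>_def)
      show "\<exists>w\<in>S. dom (\<beta> s) \<subseteq> dom (\<beta> w) \<and> dom (\<beta> t) \<subseteq> dom (\<beta> w)" if st: "s \<in> S" "t \<in> S" for s t
      proof -
        \<comment> \<open>The domain of \<open>\<beta> s\<close> is the ideal of d(s), which is the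
          idempotent s*s of S. A common upper bound h of two such idempotents satisfies d(h) = h, so
          \<open>\<beta> h\<close> is defined on the ideal of h, which contains both
          domains.\<close>
        have idem: "g_d G ` s \<in> gset_idempotents G S" "g_d G ` s \<subseteq> g_units G" if "s \<in> S" for s
        proof -
          show u: "g_d G ` s \<subseteq> g_units G"
            using subsetD[OF open_gsets_sub[OF SG[OF that]]] by (intro image_subsetI d_in_units)
          have "g_d G ` s \<in> S"
            using gset_mult_star_self[OF SG[OF that]] S.sg_closed[of "gset_star G s" s] assms(4) that
            by (simp add: full_inverse_subsemigroup_def)
          then show "g_d G ` s \<in> gset_idempotents G S"
            using gset_mult_units[OF u u] by (simp add: gset_idempotents_def)
        qed
        obtain h where h: "h \<in> gset_idempotents G S"
            "g_d G ` s = gset_mult G (g_d G ` s) h" "g_d G ` t = gset_mult G (g_d G ` t) h"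
          using full_upper_bound[OF assms(4) idem(1)[OF st(1)] idem(1)[OF st(2)]] .
        have hS: "h \<in> S" "h \<subseteq> g_units G"
          using h(1) gset_idempotent_units[OF SG, of h] by (simp_all add: gset_idempotents_def)
        have "g_d G ` h = h" by (rule units_domain[OF hS(2)])
        moreover have "g_d G ` s \<subseteq> h" "g_d G ` t \<subseteq> h"
          using h(2,3) unfolding gset_mult_units[OF idem(2)[OF st(1)] hS(2)]
            gset_mult_units[OF idem(2)[OF st(2)] hS(2)] inf.order_iff by this+
        ultimately show ?thesis
          using hS(1) st by (intro bexI[of _ h]) (simp_all add: dom Gamma0_on_mono)
      qed
      have sub: "cs_subspace ?\<Gamma> (cs_carrier ?\<Gamma>)"
        by (simp add: cs_subspace_def \<Gamma>.zero_closed \<Gamma>.add_closed \<Gamma>.scale_closed)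
      let ?U = "\<Union>s\<in>S. dom (\<beta> s)"
      have "cs_subspace ?\<Gamma> hull ?U \<subseteq> cs_carrier ?\<Gamma>"
        using sub by (intro hull_minimal) (auto simp: dom Gamma0_on_def)
      \<comment> \<open>This settles the zero alternative of \<open>Gamma0_on_dense\<close>, also
        when the union of the domains is empty.\<close>
      moreover have "cs_zero ?\<Gamma> \<in> cs_subspace ?\<Gamma> hull ?U"
        by (auto simp: hull_def cs_subspace_def)
      moreover have "?U \<subseteq> cs_subspace ?\<Gamma> hull ?U" by (rule hull_subset)
      \<comment> \<open>Half the radius turns the weak inequality of \<open>Gamma0_on_dense\<close>
        into the strict one defining a ball.\<close>
      ultimately have "\<exists>g \<in> cs_subspace ?\<Gamma> hull ?U. g \<in> M.mball f r"
        if "f \<in> cs_carrier ?\<Gamma>" "r > 0" for f r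
        using Gamma0_on_dense[OF assms(4) that(1), of "r/2"] that dom
        by (smt (verit) M.in_mball UN_iff field_sum_of_halves subset_iff)
      then show "cs_topology ?\<Gamma> closure_of (cs_subspace ?\<Gamma> hull ?U) = cs_carrier ?\<Gamma>"
        unfolding cs_topology_def M.metric_closure_of by blast
    qed
    show "partial_iso ?\<Gamma> (Gamma0_on X A (g_d G ` s)) (Gamma0_on X A (g_r G ` s)) (\<beta> s)" if "s \<in> S" for s
      by (rule iso[OF that])
    show "the (\<beta> s f) u = (if u \<in> g_r G ` s
        then \<alpha> (gset_at G u s) (f (g_d G (gset_at G u s))) else b_zero A u)"
      if "s \<in> S" "f \<in> Gamma0_on X A (g_d G ` s)" "u \<in> g_units G" for s f u
      using that by (simp add: \<beta>_def transport_map_def transport_def)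
  next
    fix \<gamma>
    assume \<gamma>: "inverse_semigroup_action S (gset_mult G) ?\<Gamma> \<gamma> \<and>
      (\<forall>s\<in>S. partial_iso ?\<Gamma> (Gamma0_on X A (g_d G ` s)) (Gamma0_on X A (g_r G ` s)) (\<gamma> s) \<and>
        (\<forall>f\<in>Gamma0_on X A (g_d G ` s). \<forall>u\<in>g_units G. the (\<gamma> s f) u =
          (if u \<in> g_r G ` s then \<alpha> (gset_at G u s) (f (g_d G (gset_at G u s))) else b_zero A u)))"
    \<comment> \<open>Off S both maps are undefined by extensionality. For s in S,
      \<open>partial_iso\<close> fixes the domain, the formula fixes the values on units, and
      sections are extensional elsewhere.\<close>
    show "\<gamma> = \<beta>"
    proof
      fix s
      show "\<gamma> s = \<beta> s"
      proof (cases "s \<in> S")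
        case True
        have \<gamma>iso: "partial_iso ?\<Gamma> (Gamma0_on X A (g_d G ` s)) (Gamma0_on X A (g_r G ` s)) (\<gamma> s)"
          using \<gamma> True by blast
        show ?thesis
        proof
          fix f
          show "\<gamma> s f = \<beta> s f"
          proof (cases "f \<in> Gamma0_on X A (g_d G ` s)")
            case f: True
            then obtain g h where g: "\<gamma> s f = Some g" and h: "\<beta> s f = Some h"
              using \<gamma>iso iso[OF True] unfolding partial_iso_def by blast
            have "g \<in> cs_carrier ?\<Gamma>" "h \<in> cs_carrier ?\<Gamma>"
              using \<gamma>iso iso[OF True] ranI[of "\<gamma> s", OF g] ranI[of "\<beta> s", OF h]
              unfolding partial_iso_def Gamma0_on_def by auto
            moreover have "g u = h u" if "u \<in> topspace X" for u
            proof -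
              have "the (\<gamma> s f) u = the (\<beta> s f) u"
                using \<gamma> True f that by (simp add: units_topspace \<beta>_def transport_map_def transport_def)
              then show ?thesis by (simp add: g h)
            qed
            ultimately show ?thesis using g h Gamma0_eqI by metis
          next
            case False
            then show ?thesis
              using \<gamma>iso iso[OF True] unfolding partial_iso_def by (metis domIff)
          qed
        qed
      next
        case False
        then show ?thesis
          using \<gamma> by (auto simp: inverse_semigroup_action_def inverse_semigroup_action_axioms_def
              \<beta>_def intro: PiE_arb)
      qed
    qed
  qed
qed

end
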